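(* Let $G$ be a ($C_4$, prism)-free perfect graph and let $(H,v)$ be a line wheel in $G$ with $H=a\hbox{-}b\hbox{-}\dots\hbox{-}c\hbox{-}d\hbox{-}\dots\hbox{-}a$ and $N(v)\cap V(H)=\{a,b,c,d\}$. Let $P$ be the path in $H\setminus b$ from $a$ to $d$, and let $Q$ be the path in $H\setminus a$ from $b$ to $c$. Then $v$ has a neighbor in every path from $P\setminus a$ to $Q\setminus c$ and in every path from $P\setminus d$ to $Q\setminus b$. In particular, $v$ breaks each of the sets $\{a\}\cup Q^*$, $\{d\}\cup Q^*$, $\{b\}\cup P^*$ and $\{c\}\cup P^*$.
   Context: All graphs finite and simple; paths are induced paths; for a path $R$ with ends $x,y$, $R^*=V(R)\setminus\{x,y\}$. A hole is an induced cycle of length at least 4; $C_4$ is the hole of length 4. A prism is two vertex-disjoint triangles $\{a_1,a_2,a_3\}$, $\{b_1,b_2,b_3\}$ with three vertex-disjoint paths $P_i$ from $a_i$ to $b_i$ such that for $i<j$ the only edges between $V(P_i)$ and $V(P_j)$ are $a_ia_j,b_ib_j$. A wheel $(H,v)$ is a hole $H$ and a vertex $v$ with at least three neighbors in $H$; a sector is a subpath of $H$ of length $\ge1$ whose ends are adjacent to $v$ and whose interior is anticomplete to $v$; short if of length 1. A line wheel is a wheel with exactly four sectors, exactly two of which are short, the two short sectors having no common vertex. For disjoint, mutually anticomplete $A,B\subseteq V(G)$, a path from $A$ to $B$ is a minimal path $x_1\hbox{-}\dots\hbox{-}x_n$ in $G\setminus(A\cup B)$ such that $x_1$ has a neighbor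 in $A$ and $x_n$ has a neighbor in $B$. For $X\subseteq V(G)$, $N[X]$ is $X$ together with all vertices having a neighbor in $X$. For $Y\subseteq V(G)$ and $u\notin Y$, $u$ breaks $Y$ if for every connected component $D$ of $G\setminus N[u]$, $Y\not\subseteq N[D]$.
   Formalization: The paths from P\a to Q\c and from P\d to Q\b are required not to contain v: the one-vertex path v is itself such a path, and v has no neighbor in it; no other path is excluded. *)

theory Defs
  imports Main
begin

definition graph :: "'a set \<Rightarrow> ('a \<Rightarrow> 'a \<Rightarrow> bool) \<Rightarrow> bool" where
  "graph V E \<longleftrightarrow> finite V \<and> (\<forall>x y. E x y \<longrightarrow> x \<in> V \<and> y \<in> V)
     \<and> (\<forall>x y. E x y \<longrightarrow> E y x) \<and> (\<forall>x. \<not> E x x)"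

definition clique_number :: "('a \<Rightarrow> 'a \<Rightarrow> bool) \<Rightarrow> 'a set \<Rightarrow> nat" where
  "clique_number E S = Max {card K | K. K \<subseteq> S \<and> (\<forall>x\<in>K. \<forall>y\<in>K. x \<noteq> y \<longrightarrow> E x y)}"

definition chromatic_number :: "('a \<Rightarrow> 'a \<Rightarrow> bool) \<Rightarrow> 'a set \<Rightarrow> nat" where
  "chromatic_number E S = (LEAST k. \<exists>f :: 'a \<Rightarrow> nat. (\<forall>x\<in>S. f x < k)
      \<and> (\<forall>x\<in>S. \<forall>y\<in>S. E x y \<longrightarrow> f x \<noteq> f y))"

definition perfect :: "'a set \<Rightarrow> ('a \<Rightarrow> 'a \<Rightarrow> bool) \<Rightarrow> bool" where
  "perfect V E \<longleftrightarrow> (\<forall>S\<subseteq>V. chromatic_number E S = clique_number E S)"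

definition is_path :: "'a set \<Rightarrow> ('a \<Rightarrow> 'a \<Rightarrow> bool) \<Rightarrow> 'a list \<Rightarrow> bool" where
  "is_path V E xs \<longleftrightarrow> xs \<noteq> [] \<and> distinct xs \<and> set xs \<subseteq> V \<and>
     (\<forall>i<length xs. \<forall>j<length xs. E (xs!i) (xs!j) \<longleftrightarrow> (i = Suc j \<or> j = Suc i))"

definition is_hole :: "'a set \<Rightarrow> ('a \<Rightarrow> 'a \<Rightarrow> bool) \<Rightarrow> 'a list \<Rightarrow> bool" where
  "is_hole V E hs \<longleftrightarrow> length hs \<ge> 4 \<and> distinct hs \<and> set hs \<subseteq> V \<and>
     (\<forall>i<length hs. \<forall>j<length hs.
        E (hs!i) (hs!j) \<longleftrightarrow> (j = Suc i mod length hs \<or> i = Suc j mod length hs))"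

definition C4_free :: "'a set \<Rightarrow> ('a \<Rightarrow> 'a \<Rightarrow> bool) \<Rightarrow> bool" where
  "C4_free V E \<longleftrightarrow> \<not> (\<exists>hs. is_hole V E hs \<and> length hs = 4)"

definition is_prism :: "'a set \<Rightarrow> ('a \<Rightarrow> 'a \<Rightarrow> bool) \<Rightarrow> (nat \<Rightarrow> 'a list) \<Rightarrow> bool" where
  "is_prism V E P \<longleftrightarrow>
     (\<forall>i<3. is_path V E (P i)) \<and>
     (\<forall>i<3. \<forall>j<3. i \<noteq> j \<longrightarrow> E (hd (P i)) (hd (P j)) \<and> E (last (P i)) (last (P j))) \<and>
     {hd (P 0), hd (P 1), hd (P 2)} \<inter> {last (P 0), last (P 1), last (P 2)} = {} \<and>
     (\<forall>i<3. \<forall>j<3. i \<noteq> j \<longrightarrow> set (P i) \<inter> set (P j) = {}) \<and>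
     (\<forall>i<3. \<forall>j<3. i < j \<longrightarrow> (\<forall>x\<in>set (P i). \<forall>y\<in>set (P j).
        E x y \<longrightarrow> (x = hd (P i) \<and> y = hd (P j)) \<or> (x = last (P i) \<and> y = last (P j))))"

definition prism_free :: "'a set \<Rightarrow> ('a \<Rightarrow> 'a \<Rightarrow> bool) \<Rightarrow> bool" where
  "prism_free V E \<longleftrightarrow> \<not> (\<exists>P. is_prism V E P)"

definition is_wheel :: "'a set \<Rightarrow> ('a \<Rightarrow> 'a \<Rightarrow> bool) \<Rightarrow> 'a list \<Rightarrow> 'a \<Rightarrow> bool" where
  "is_wheel V E hs v \<longleftrightarrow> is_hole V E hs \<and> v \<in> V \<and> card {x \<in> set hs. E v x} \<ge> 3"

definition segment :: "'a list \<Rightarrow> nat \<Rightarrow> nat \<Rightarrow> 'a set" where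
  "segment hs i l = {hs ! ((i + j) mod length hs) | j. j \<le> l}"

definition sectors :: "('a \<Rightarrow> 'a \<Rightarrow> bool) \<Rightarrow> 'a list \<Rightarrow> 'a \<Rightarrow> (nat \<times> nat) set" where
  "sectors E hs v = {(i, l). i < length hs \<and> 1 \<le> l \<and> l < length hs \<and>
      E v (hs ! i) \<and> E v (hs ! ((i + l) mod length hs)) \<and>
      (\<forall>j. 0 < j \<and> j < l \<longrightarrow> \<not> E v (hs ! ((i + j) mod length hs)))}"

definition line_wheel :: "'a set \<Rightarrow> ('a \<Rightarrow> 'a \<Rightarrow> bool) \<Rightarrow> 'a list \<Rightarrow> 'a \<Rightarrow> bool" where
  "line_wheel V E hs v \<longleftrightarrow> is_wheel V E hs v \<and> card (sectors E hs v) = 4 \<and>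
     card {s \<in> sectors E hs v. snd s = 1} = 2 \<and>
     (\<forall>s\<in>sectors E hs v. \<forall>t\<in>sectors E hs v. snd s = 1 \<and> snd t = 1 \<and> s \<noteq> t \<longrightarrow>
        segment hs (fst s) (snd s) \<inter> segment hs (fst t) (snd t) = {})"

definition interior :: "'a list \<Rightarrow> 'a set" where
  "interior R = set R - {hd R, last R}"

definition links :: "('a \<Rightarrow> 'a \<Rightarrow> bool) \<Rightarrow> 'a set \<Rightarrow> 'a set \<Rightarrow> 'a list \<Rightarrow> bool" where
  "links E A B xs \<longleftrightarrow> (\<exists>y\<in>A. E (hd xs) y) \<and> (\<exists>y\<in>B. E (last xs) y)"

definition path_from :: "'a set \<Rightarrow> ('a \<Rightarrow> 'a \<Rightarrow> bool) \<Rightarrow> 'a set \<Rightarrow> 'a set \<Rightarrow> 'a list \<Rightarrow> bool" where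
  "path_from V E A B xs \<longleftrightarrow> is_path V E xs \<and> set xs \<inter> (A \<union> B) = {} \<and> links E A B xs \<and>
     \<not> (\<exists>ys. is_path V E ys \<and> set ys \<subset> set xs \<and> links E A B ys)"

definition cnbhd :: "'a set \<Rightarrow> ('a \<Rightarrow> 'a \<Rightarrow> bool) \<Rightarrow> 'a set \<Rightarrow> 'a set" where
  "cnbhd V E X = X \<union> {y \<in> V. \<exists>x\<in>X. E y x}"

definition component :: "('a \<Rightarrow> 'a \<Rightarrow> bool) \<Rightarrow> 'a set \<Rightarrow> 'a set \<Rightarrow> bool" where
  "component E S D \<longleftrightarrow> (\<exists>x\<in>S. D = {y. (\<lambda>u w. u \<in> S \<and> w \<in> S \<and> E u w)\<^sup>*\<^sup>* x y})"

definition breaks :: "'a set \<Rightarrow> ('a \<Rightarrow> 'a \<Rightarrow> bool) \<Rightarrow> 'a \<Rightarrow> 'a set \<Rightarrow> bool" where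
  "breaks V E u Y \<longleftrightarrow> (\<forall>D. component E (V - cnbhd V E {u}) D \<longrightarrow> \<not> Y \<subseteq> cnbhd V E D)"

end

theory Submission
  imports Defs
begin

text \<open>
  Write \<open>P\<close> as a path from \<open>a\<close> to \<open>d\<close> and \<open>Q\<close> as a path from \<open>b\<close> to \<open>c\<close>. Suppose a shortest path
  \<open>R = x\<^sub>1 \<dots> x\<^sub>n\<close> linking \<open>P - a\<close> to \<open>Q - c\<close> is anticomplete to \<open>v\<close>; then only \<open>x\<^sub>1\<close> attaches to
  \<open>P - a\<close> and only \<open>x\<^sub>n\<close> attaches to \<open>Q - c\<close>. The main tool is that when two adjacent vertices of
  a hole and the first vertex of a path form a triangle, and only the last vertex of the path
  attaches elsewhere to the hole, there is an odd hole or a prism. Applied to the hole \<open>v-P-v\<close>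
  with the triangle \<open>v,a,b\<close>, and to its mirror image, it shows that both \<open>a\<close> and \<open>c\<close> have
  neighbours in \<open>R\<close>. A minimal subpath \<open>S\<close> of \<open>R\<close> between a neighbour of \<open>a\<close> and one of \<open>c\<close>
  closes to a hole through \<open>v\<close>, and, if it misses \<open>x\<^sub>1\<close>, to a hole through \<open>P\<close> of the other
  parity; so \<open>S\<close> contains \<open>x\<^sub>1\<close>, likewise \<open>x\<^sub>n\<close>, and \<open>S = R\<close>. If \<open>a\<close> is adjacent to \<open>x\<^sub>1\<close> and
  \<open>c\<close> to \<open>x\<^sub>n\<close>, the tool applies again. Otherwise \<open>x\<^sub>1\<close> is adjacent to \<open>c\<close>, and in \<open>P\<close> only to
  \<open>d\<close>, while \<open>x\<^sub>n\<close> is adjacent to \<open>a\<close>, and in \<open>Q\<close> only to \<open>b\<close>; then \<open>P\<close>, \<open>Q\<close>, \<open>R\<close> form a prism.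
\<close>

section \<open>Induced paths and holes\<close>

locale simple_graph =
  fixes V :: "'a set" and E :: "'a \<Rightarrow> 'a \<Rightarrow> bool"
  assumes graph: "graph V E"
begin

lemma E_sym: "E x y \<longleftrightarrow> E y x"
  using graph unfolding graph_def by blast

lemma E_irrefl [simp]: "\<not> E x x"
  using graph unfolding graph_def by blast

lemma is_path_single [simp]: "is_path V E [x] \<longleftrightarrow> x \<in> V"
  by (auto simp: is_path_def)

lemma is_path_Cons:
  assumes "xs \<noteq> []"
  shows "is_path V E (x # xs) \<longleftrightarrow> x \<in> V \<and> x \<notin> set xs \<and> is_path V E xs \<and>
    (\<forall>y\<in>set xs. E x y \<longleftrightarrow> y = hd xs)"
proof -
  have *: "(\<forall>j<length xs. E x (xs ! j) \<longleftrightarrow> j = 0) \<longleftrightarrow> (\<forall>y\<in>set xs. E x y \<longleftrightarrow> y = hd xs)"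
    if "distinct xs"
    using that assms
    by (auto simp: all_set_conv_all_nth hd_conv_nth nth_eq_iff_index_eq)
  have "(\<forall>i<length (x # xs). \<forall>j<length (x # xs).
            E ((x # xs) ! i) ((x # xs) ! j) \<longleftrightarrow> (i = Suc j \<or> j = Suc i)) \<longleftrightarrow>
        (\<forall>j<length xs. E x (xs ! j) \<longleftrightarrow> j = 0) \<and>
        (\<forall>i<length xs. \<forall>j<length xs. E (xs ! i) (xs ! j) \<longleftrightarrow> (i = Suc j \<or> j = Suc i))"
    by (auto simp: All_less_Suc2 E_sym[of _ x])
  then show ?thesis
    unfolding is_path_def using * assms by auto
qed

lemma is_path_append:
  assumes "xs \<noteq> []" "ys \<noteq> []"
  shows "is_path V E (xs @ ys) \<longleftrightarrow> is_path V E xs \<and> is_path V E ys \<and> set xs \<inter> set ys = {} \<and>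
    (\<forall>x\<in>set xs. \<forall>y\<in>set ys. E x y \<longleftrightarrow> x = last xs \<and> y = hd ys)"
  using assms(1)
proof (induction xs)
  case (Cons x xs)
  show ?case
  proof (cases "xs = []")
    case True
    then show ?thesis using assms by (auto simp: is_path_Cons)
  next
    case False
    then have "x \<notin> set xs \<Longrightarrow> x \<noteq> last xs" by auto
    moreover have "hd xs \<in> set ys \<Longrightarrow> set xs \<inter> set ys \<noteq> {}"
      using False by (metis disjoint_iff hd_in_set)
    ultimately show ?thesis using False Cons.IH assms by (auto simp: is_path_Cons)
  qed
qed simp

lemma is_path_rev [simp]: "is_path V E (rev xs) \<longleftrightarrow> is_path V E xs"
proof (induction xs)
  case (Cons x xs)
  show ?case
    by (cases "xs = []") (auto simp: is_path_append is_path_Cons Cons.IH last_rev E_sym[of _ x])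
qed simp

lemma is_path_appendD1: "is_path V E (xs @ ys) \<Longrightarrow> xs \<noteq> [] \<Longrightarrow> is_path V E xs"
  by (cases "ys = []") (auto simp: is_path_append)

lemma is_path_appendD2: "is_path V E (xs @ ys) \<Longrightarrow> ys \<noteq> [] \<Longrightarrow> is_path V E ys"
  by (cases "xs = []") (auto simp: is_path_append)

lemma is_path_ends:
  assumes "is_path V E xs" "length xs \<ge> 3"
  shows "hd xs \<noteq> last xs" "\<not> E (hd xs) (last xs)"
proof -
  obtain x y z zs where "xs = x # y # z # zs"
    using assms(2) by (auto simp: numeral_3_eq_3 Suc_le_length_iff)
  with assms(1) show "hd xs \<noteq> last xs" "\<not> E (hd xs) (last xs)"
    by (auto simp: is_path_Cons)
qed

text \<open>The holes constructed later all arise by closing an induced path through one further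
  vertex. The index arithmetic modulo the length is done once here, and the constructions can work
  with heads and lasts of lists.\<close>

lemma is_hole_Cons:
  assumes p: "is_path V E xs" and len: "length xs \<ge> 3" and w: "w \<in> V" "w \<notin> set xs"
    and cap: "\<And>y. y \<in> set xs \<Longrightarrow> E w y \<longleftrightarrow> y = hd xs \<or> y = last xs"
  shows "is_hole V E (w # xs)"
proof -
  let ?n = "length xs"
  have d: "distinct xs" and ne: "xs \<noteq> []"
    and adj: "\<And>i j. i < ?n \<Longrightarrow> j < ?n \<Longrightarrow> E (xs ! i) (xs ! j) \<longleftrightarrow> i = Suc j \<or> j = Suc i"
    using p by (auto simp: is_path_def)
  have *: "E w (xs ! j) \<longleftrightarrow> j = 0 \<or> Suc j = ?n" if "j < ?n" for j
    using that cap[of "xs ! j"] d ne len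
    by (auto simp: hd_conv_nth last_conv_nth nth_eq_iff_index_eq)
  have m: "Suc (Suc j) mod Suc ?n = (if Suc j = ?n then 0 else Suc (Suc j))" if "j < ?n" for j
    using that by auto
  have "E ((w # xs) ! i) ((w # xs) ! j) \<longleftrightarrow> (j = Suc i mod Suc ?n \<or> i = Suc j mod Suc ?n)"
    if "i < Suc ?n" "j < Suc ?n" for i j
    using that len * adj m by (cases i; cases j) (auto simp: E_sym[of _ w])
  then show ?thesis
    unfolding is_hole_def using p len w by (auto simp: is_path_def)
qed

text \<open>Induction along the walk. If the new vertex already lies on the path, the path is
  truncated there; otherwise it is cut at its first neighbour of the new vertex, which keeps the
  extension induced.\<close>

lemma path_of_rtranclp:
  assumes "(\<lambda>u w. u \<in> S \<and> w \<in> S \<and> E u w)\<^sup>*\<^sup>* x y" "x \<in> S" "S \<subseteq> V"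
  shows "\<exists>xs. is_path V E xs \<and> set xs \<subseteq> S \<and> hd xs = x \<and> last xs = y"
  using assms(1)
proof (induction rule: rtranclp_induct)
  case base
  then show ?case using assms by (intro exI[of _ "[x]"]) auto
next
  case (step y z)
  then obtain xs where xs: "is_path V E xs" "set xs \<subseteq> S" "hd xs = x" "last xs = y" by blast
  have ne: "xs \<noteq> []" using xs by (auto simp: is_path_def)
  show ?case
  proof (cases "z \<in> set xs")
    case True
    then obtain X1 X2 where X: "xs = (X1 @ [z]) @ X2" by (auto dest: split_list)
    show ?thesis
      using xs is_path_appendD1[of "X1 @ [z]" X2]
      by (intro exI[of _ "X1 @ [z]"]) (auto simp: X hd_append split: if_splits)
  next
    case False
    have "\<exists>u\<in>set xs. E z u" using step xs ne E_sym by (metis last_in_set)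
    then obtain X1 u X2 where X: "xs = X1 @ u # X2" "E z u" "\<forall>w\<in>set X1. \<not> E z w"
      by (metis split_list_first_prop)
    have "is_path V E (X1 @ [u])" using xs X is_path_appendD1[of "X1 @ [u]" X2] by auto
    then have "is_path V E ((X1 @ [u]) @ [z])"
      using X False step assms by (subst is_path_append) (auto simp: E_sym[of _ z])
    then show ?thesis
      using xs step X by (intro exI[of _ "X1 @ [u, z]"]) (auto simp: hd_append split: if_splits)
  qed
qed

end

text \<open>A hole contains no triangle, so perfection makes it 2-colourable; the two colours
  alternate along the cycle, and an odd cycle does not close up.\<close>

lemma perfect_hole_even:
  assumes g: "graph V E" and "perfect V E" and h: "is_hole V E hs"
  shows "even (length hs)"
proof (rule ccontr)
  assume odd: "odd (length hs)"
  let ?n = "length hs" and ?S = "set hs"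
  have n: "?n \<ge> 4" and d: "distinct hs" and SV: "?S \<subseteq> V"
    and adj: "\<And>i j. i < ?n \<Longrightarrow> j < ?n \<Longrightarrow>
      E (hs ! i) (hs ! j) \<longleftrightarrow> j = Suc i mod ?n \<or> i = Suc j mod ?n"
    using h by (auto simp: is_hole_def)
  have tri: False if "i < ?n" "j < ?n" "l < ?n" "i \<noteq> j" "j \<noteq> l" "i \<noteq> l"
    "E (hs ! i) (hs ! j)" "E (hs ! j) (hs ! l)" "E (hs ! i) (hs ! l)" for i j l
    using that n by (auto simp: adj mod_Suc split: if_splits)
  have "card K \<le> 2" if K: "K \<subseteq> ?S" "\<forall>x\<in>K. \<forall>y\<in>K. x \<noteq> y \<longrightarrow> E x y" for K
  proof (rule ccontr)
    assume "\<not> card K \<le> 2"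
    then obtain T where "T \<subseteq> K" "card T = 3"
      by (metis not_less_eq_eq numeral_2_eq_2 numeral_3_eq_3 obtain_subset_with_card_n)
    then obtain x y z where "x \<in> K" "y \<in> K" "z \<in> K" "x \<noteq> y" "y \<noteq> z" "x \<noteq> z"
      by (auto simp: card_3_iff)
    moreover from this K have "x \<in> ?S" "y \<in> ?S" "z \<in> ?S" by auto
    then obtain i j l where "i < ?n" "j < ?n" "l < ?n" "x = hs ! i" "y = hs ! j" "z = hs ! l"
      by (auto simp: in_set_conv_nth)
    ultimately show False using K tri[of i j l] by auto
  qed
  moreover have "finite {card K | K. K \<subseteq> ?S \<and> (\<forall>x\<in>K. \<forall>y\<in>K. x \<noteq> y \<longrightarrow> E x y)}"
    by (rule finite_subset[of _ "card ` Pow ?S"]) auto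
  moreover have "{card K | K. K \<subseteq> ?S \<and> (\<forall>x\<in>K. \<forall>y\<in>K. x \<noteq> y \<longrightarrow> E x y)} \<noteq> {}"
    by (auto intro!: exI[of _ "{}"])
  ultimately have "clique_number E ?S \<le> 2"
    unfolding clique_number_def by (subst Max_le_iff) auto
  then have chi: "chromatic_number E ?S \<le> 2"
    using assms SV by (simp add: perfect_def)
  \<comment> \<open>An injective colouring shows that some number of colours suffices, so the
    \<open>LEAST\<close> in \<open>chromatic_number\<close> is attained and yields an actual
    colouring.\<close>
  obtain f :: "'a \<Rightarrow> nat" where f: "inj_on f ?S"
    using finite_imp_inj_to_nat_seg[of ?S] by auto
  let ?C = "\<lambda>k. \<exists>f :: 'a \<Rightarrow> nat. (\<forall>x\<in>?S. f x < k) \<and> (\<forall>x\<in>?S. \<forall>y\<in>?S. E x y \<longrightarrow> f x \<noteq> f y)"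
  have "?C (Suc (Max (f ` ?S)))"
    using f g by (intro exI[of _ f]) (auto simp: less_Suc_eq_le inj_on_def graph_def)
  then have "?C (chromatic_number E ?S)"
    unfolding chromatic_number_def by (rule LeastI)
  then obtain f :: "'a \<Rightarrow> nat" where f: "\<forall>x\<in>?S. f x < 2" "\<forall>x\<in>?S. \<forall>y\<in>?S. E x y \<longrightarrow> f x \<noteq> f y"
    using chi by (meson order_less_le_trans)
  have alt: "f (hs ! i) = (f (hs ! 0) + i) mod 2" if "i < ?n" for i
    using that
  proof (induction i)
    case 0
    then show ?case using f n by (simp add: hd_conv_nth)
  next
    case (Suc i)
    then have "f (hs ! i) \<noteq> f (hs ! Suc i)" "f (hs ! Suc i) < 2" "f (hs ! i) < 2"
      using f adj[of i "Suc i"] by auto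
    with Suc show ?case by (auto simp: mod_Suc split: if_splits)
  qed
  have ne: "hs \<noteq> []" using n by auto
  then have ends: "hs ! (?n - 1) \<in> ?S" "hs ! 0 \<in> ?S" by (simp_all add: nth_mem)
  have "E (hs ! (?n - 1)) (hs ! 0)" using adj[of "?n - 1" 0] n ne by simp
  then have "f (hs ! (?n - 1)) \<noteq> f (hs ! 0)" using f ends by blast
  moreover have "f (hs ! 0) < 2" using f ends by blast
  moreover obtain m where "?n = 2 * m + 1" using odd by (auto elim: oddE)
  ultimately show False using alt[of "?n - 1"] by simp
qed

section \<open>Parity of holes, and paths attached to a hole\<close>

locale square_prism_odd_hole_free = simple_graph +
  assumes C4: "C4_free V E" and prism: "prism_free V E"
    and even_hole: "\<And>hs. is_hole V E hs \<Longrightarrow> even (length hs)"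
begin

text \<open>The second claim excludes the hole of length 4.\<close>

lemma odd_length_path:
  assumes "is_path V E xs" "length xs \<ge> 3" "w \<in> V" "w \<notin> set xs"
    and "\<And>y. y \<in> set xs \<Longrightarrow> E w y \<longleftrightarrow> y = hd xs \<or> y = last xs"
  shows "odd (length xs)" "length xs \<noteq> 3"
  using is_hole_Cons[OF assms] even_hole[of "w # xs"] C4 by (auto simp: C4_free_def)

text \<open>A form of prism-freeness for three named paths. Each equivalence supplies two triangle
  edges and at the same time forbids all other edges between its two paths.\<close>

lemma no_prism:
  assumes "is_path V E A" "is_path V E B" "is_path V E C"
    and "hd A \<noteq> last A" "hd B \<noteq> last B" "hd C \<noteq> last C"
    and "set A \<inter> set B = {}" "set A \<inter> set C = {}" "set B \<inter> set C = {}"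
    and "\<And>x y. x \<in> set A \<Longrightarrow> y \<in> set B \<Longrightarrow> E x y \<longleftrightarrow> x = hd A \<and> y = hd B \<or> x = last A \<and> y = last B"
    and "\<And>x y. x \<in> set A \<Longrightarrow> y \<in> set C \<Longrightarrow> E x y \<longleftrightarrow> x = hd A \<and> y = hd C \<or> x = last A \<and> y = last C"
    and "\<And>x y. x \<in> set B \<Longrightarrow> y \<in> set C \<Longrightarrow> E x y \<longleftrightarrow> x = hd B \<and> y = hd C \<or> x = last B \<and> y = last C"
  shows False
proof -
  have ends: "hd A \<in> set A" "last A \<in> set A" "hd B \<in> set B" "last B \<in> set B"
    "hd C \<in> set C" "last C \<in> set C"
    using assms(1-3) by (auto simp: is_path_def)
  have less3: "(\<forall>i<3. R i) \<longleftrightarrow> R 0 \<and> R 1 \<and> R 2" for R :: "nat \<Rightarrow> bool"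
    by (auto simp: numeral_3_eq_3 numeral_2_eq_2 less_Suc_eq)
  have "E (hd A) (hd B)" "E (hd A) (hd C)" "E (hd B) (hd C)"
    "E (last A) (last B)" "E (last A) (last C)" "E (last B) (last C)"
    using ends assms(10-12) by blast+
  moreover from this have "E (hd B) (hd A)" "E (hd C) (hd A)" "E (hd C) (hd B)"
    "E (last B) (last A)" "E (last C) (last A)" "E (last C) (last B)"
    using E_sym by blast+
  moreover have "{hd A, hd B, hd C} \<inter> {last A, last B, last C} = {}"
    using ends assms(4-9) by (auto simp: disjoint_iff)
  moreover have "set B \<inter> set A = {}" "set C \<inter> set A = {}" "set C \<inter> set B = {}"
    using assms(7-9) by auto
  ultimately have "is_prism V E (\<lambda>i. if i = 0 then A else if i = 1 then B else C)"
    using assms unfolding is_prism_def less3 by simp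
  then show False using prism by (auto simp: prism_free_def)
qed

text \<open>The main tool: \<open>z\<close> closes \<open>N\<close> to a hole, and \<open>z\<close>,
  \<open>hd N\<close>, \<open>hd W\<close> form a triangle. Splitting the hole at the first and last
  neighbours of \<open>last W\<close> gives further holes; their parities clash unless these two
  neighbours are adjacent, and then there is a prism.\<close>

lemma no_attachment:
  assumes N: "is_path V E N" "length N \<ge> 3" and z: "z \<in> V" "z \<notin> set N" "z \<notin> set W"
    and cap: "\<And>y. y \<in> set N \<Longrightarrow> E z y \<longleftrightarrow> y = hd N \<or> y = last N"
    and W: "is_path V E W" "length W \<ge> 2" "set W \<inter> set N = {}"
    and zW: "\<And>x. x \<in> set W \<Longrightarrow> E z x \<longleftrightarrow> x = hd W"
    and hW: "\<And>x. x \<in> set W \<Longrightarrow> E (hd N) x \<longleftrightarrow> x = hd W"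
    and WN: "\<And>x y. x \<in> set W \<Longrightarrow> y \<in> set (tl N) \<Longrightarrow> E x y \<Longrightarrow> x = last W"
    and att: "\<exists>y\<in>set (tl N). E (last W) y"
  shows False
proof -
  define w where "w = last W"
  have Wne: "W \<noteq> []" using W by auto
  have w: "w \<in> set W" "w \<noteq> hd W"
    using W by (cases W; auto simp: w_def is_path_def)+
  obtain e M where NM: "N = e # M" using N by (cases N) auto
  have Mne: "M \<noteq> []" using att NM by auto
  have M: "is_path V E M" "e \<in> V" "e \<notin> set M" "\<And>y. y \<in> set M \<Longrightarrow> E e y \<longleftrightarrow> y = hd M"
    using N Mne by (auto simp: NM is_path_Cons)
  have MW: "set M \<inter> set W = {}" "e \<notin> set W" using W NM by auto
  \<comment> \<open>\<open>f\<close> and \<open>g\<close> are the first and the last neighbour of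
    \<open>w\<close> on \<open>M\<close>, possibly equal at this stage; \<open>K\<close> is the
    stretch from \<open>f\<close> up to, but excluding, \<open>g\<close>.\<close>
  obtain M1 f L where f: "M = M1 @ f # L" "E w f" "\<forall>y\<in>set M1. \<not> E w y"
    using att split_list_first_prop[of M "E w"] by (auto simp: NM w_def)
  obtain K g M2 where g: "f # L = K @ g # M2" "E w g" "\<forall>y\<in>set M2. \<not> E w y"
    using f(2) split_list_last_prop[of "f # L" "E w"] by auto
  have MK: "M = M1 @ K @ g # M2" using f g by simp
  have dM: "distinct M" using M by (simp add: is_path_def)
  have p1: "is_path V E (M1 @ [f])" using is_path_appendD1[of "M1 @ [f]" L] M f by simp
  have p2: "is_path V E (g # M2)" using is_path_appendD2[of "M1 @ K" "g # M2"] M MK by simp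
  have WM: "x = w" if "x \<in> set W" "y \<in> set M" "E x y \<or> E y x" for x y
    using that WN[of x y] E_sym[of y x] by (auto simp: NM w_def)
  have f': "E f w" "\<forall>y\<in>set M1. \<not> E y w" and g': "E g w" "\<forall>y\<in>set M2. \<not> E y w"
    using f g E_sym by blast+
  have sub1: "set (M1 @ [f]) \<subseteq> set M" by (auto simp: f(1))
  have sub2: "set (g # M2) \<subseteq> set M" by (auto simp: MK)
  note sub = sub1 sub2
  have ends: "last N = last (g # M2)" "hd N = e" by (simp_all add: NM MK)
  have hdM: "hd M = hd (M1 @ [f])" by (simp add: f(1) hd_append)
  have MW1: "E x y \<longleftrightarrow> x = f \<and> y = w" if "x \<in> set (M1 @ [f])" "y \<in> set W" for x y
    using that WM[of y x] f' sub by auto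
  \<comment> \<open>First hole: \<open>e\<close>, \<open>M1\<close>, \<open>f\<close>, then
    \<open>W\<close> backwards to the neighbour \<open>hd W\<close> of \<open>e\<close>.\<close>
  then have "is_path V E ((M1 @ [f]) @ rev W)"
    using p1 W MW Wne sub by (subst is_path_append) (auto simp: hd_rev w_def[symmetric])
  moreover have "E e y \<longleftrightarrow> y = hd ((M1 @ [f]) @ rev W) \<or> y = last ((M1 @ [f]) @ rev W)"
    if "y \<in> set ((M1 @ [f]) @ rev W)" for y
  proof (cases "y \<in> set W")
    case True
    then show ?thesis using hW[of y] Wne sub MW
      by (cases M1) (auto simp: NM last_rev)
  next
    case False
    then show ?thesis using that M(4)[of y] sub hdM Wne
      by (auto simp: last_rev hd_append)
  qed
  ultimately have odd1: "odd (length ((M1 @ [f]) @ rev W))"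
    using W(2) M(2,3) MW sub
    by (intro odd_length_path(1)[of _ e]) auto
  have MW2: "E x y \<longleftrightarrow> x = w \<and> y = g" if "x \<in> set W" "y \<in> set (g # M2)" for x y
    using that WM[of x y] g sub by auto
  \<comment> \<open>Second hole: \<open>z\<close>, then \<open>W\<close>, \<open>g\<close>,
    \<open>M2\<close>, back to \<open>z\<close>.\<close>
  then have "is_path V E (W @ g # M2)"
    using p2 W MW Wne sub by (subst is_path_append) (auto simp: w_def[symmetric])
  moreover have "E z y \<longleftrightarrow> y = hd (W @ g # M2) \<or> y = last (W @ g # M2)"
    if "y \<in> set (W @ g # M2)" for y
  proof (cases "y \<in> set W")
    case True
    moreover have "last (g # M2) \<notin> set W" using sub MW by (meson disjoint_iff last_in_set list.discI subsetD)
    ultimately show ?thesis using zW[of y] Wne by auto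
  next
    case False
    then have "y \<in> set (g # M2)" using that by simp
    with False show ?thesis using cap[of y] sub ends Wne M(3) by (auto simp: NM)
  qed
  ultimately have odd2: "odd (length (W @ g # M2))"
    using W(2) z sub
    by (intro odd_length_path(1)[of _ z]) (auto simp: NM)
  have "odd (length N)"
    using N z cap by (intro odd_length_path(1)[of N z]) auto
  \<comment> \<open>Together with the hole through \<open>z\<close> and \<open>N\<close>, the
    parities make \<open>K\<close> of odd length. Hence \<open>f\<close> and \<open>g\<close>
    differ, and \<open>K'\<close> lists the vertices strictly between them.\<close>
  with odd1 odd2 have par: "even (length M1 + length M2)" "odd (length K)"
    by (auto simp: NM MK)
  then obtain K' where K: "K = f # K'" using g by (cases K) auto
  let ?A = "e # M1 @ [f]"
  have N': "is_path V E (?A @ K' @ g # M2)" using N(1) by (simp add: NM MK K)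
  have A: "is_path V E ?A" and gM: "is_path V E (K' @ g # M2)"
    using is_path_appendD1[OF N'] is_path_appendD2[OF N'] by simp_all
  have disj: "set ?A \<inter> set (K' @ g # M2) = {}"
    and no': "\<And>x y. x \<in> set ?A \<Longrightarrow> y \<in> set (K' @ g # M2) \<Longrightarrow>
      E x y \<longleftrightarrow> x = f \<and> y = hd (K' @ g # M2)"
    using iffD1[OF is_path_append N'] by (simp_all del: set_append set_simps)
  have ew: "\<not> E e w" "\<not> E z w" using zW[of w] hW[of w] w by (auto simp: NM)
  have setN: "set N = set ?A \<union> set (K' @ g # M2)" by (auto simp: NM MK K)
  have lastN: "last (g # M2) \<in> set (g # M2)" by simp
  have WN0: "set ?A \<inter> set W = {}" "set (g # M2) \<inter> set W = {}" using W(3) by (auto simp: setN)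
  have zA: "E z x \<longleftrightarrow> x = e" if "x \<in> set ?A" for x
    using that cap[of x] ends lastN disj by (auto simp: setN)
  have zC: "E z x \<longleftrightarrow> x = last (g # M2)" if "x \<in> set (g # M2)" for x
    using that cap[of x] ends disj by (auto simp: setN)
  have zA': "E x z \<longleftrightarrow> x = e" if "x \<in> set ?A" for x
    using zA[OF that] by (subst E_sym)
  have zW': "E x z \<longleftrightarrow> x = hd W" if "x \<in> set W" for x
    using zW[OF that] by (subst E_sym)
  show False
  proof (cases "K' = []")
    case True
    \<comment> \<open>Here \<open>f\<close> and \<open>g\<close> are adjacent: \<open>?A\<close>,
      \<open>W\<close> and \<open>?C\<close> join the triangle \<open>e\<close>,
      \<open>hd W\<close>, \<open>z\<close> to the triangle \<open>f\<close>, \<open>w\<close>,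
      \<open>g\<close>.\<close>
    let ?C = "z # rev (g # M2)"
    have "is_path V E (rev (g # M2))" using p2 by (simp only: is_path_rev)
    then have C: "is_path V E ?C"
      using z zC
      by (subst is_path_Cons) (auto simp: hd_rev setN simp del: rev.simps is_path_rev)
    have hl: "hd ?A = e" "last ?A = f" "hd ?C = z" "last ?C = g" by simp_all
    have efg: "e \<noteq> f" "z \<noteq> g" "z \<notin> set (g # M2)" using M(3) sub1 z setN by auto
    have "E x y \<longleftrightarrow> x = hd ?A \<and> y = hd W \<or> x = last ?A \<and> y = last W"
      if "x \<in> set ?A" "y \<in> set W" for x y
    proof (cases "x = e")
      case True
      then show ?thesis using hW[OF that(2)] efg unfolding hl ends by simp
    next
      case False
      then show ?thesis using MW1[of x y] that unfolding hl w_def by simp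
    qed
    moreover have "E x y \<longleftrightarrow> x = hd ?A \<and> y = hd ?C \<or> x = last ?A \<and> y = last ?C"
      if "x \<in> set ?A" "y \<in> set ?C" for x y
    proof (cases "y = z")
      case True
      then show ?thesis using zA'[OF that(1)] efg unfolding hl by simp
    next
      case False
      then show ?thesis using no'[OF that(1), of y] that(2) True unfolding hl by simp
    qed
    moreover have "E x y \<longleftrightarrow> x = hd W \<and> y = hd ?C \<or> x = last W \<and> y = last ?C"
      if "x \<in> set W" "y \<in> set ?C" for x y
    proof (cases "y = z")
      case True
      then show ?thesis using zW'[OF that(1)] efg unfolding hl by simp
    next
      case False
      then show ?thesis using MW2[OF that(1), of y] that(2) unfolding hl w_def by simp
    qed
    moreover have "set ?A \<inter> set ?C = {}" "set W \<inter> set ?C = {}"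
      using disj WN0 z by (auto simp: setN)
    moreover have "hd ?A \<noteq> last ?A" "hd W \<noteq> last W" "hd ?C \<noteq> last ?C"
      using efg w by (auto simp: w_def)
    ultimately show False
      using no_prism[OF A W(1) C] WN0(1) by blast
  next
    \<comment> \<open>Now \<open>f\<close> and \<open>g\<close> are nonadjacent, so replacing the
      stretch between them by \<open>w\<close> gives another hole through \<open>z\<close>, of the
      wrong parity.\<close>
    case False
    then have no: "\<not> E x y" if "x \<in> set ?A" "y \<in> set (g # M2)" for x y
      using that no'[of x y] gM by (cases K') (auto simp: is_path_def)
    have wV: "w \<in> V" using W w by (auto simp: is_path_def)
    have "is_path V E (w # g # M2)"
      using p2 wV w WN0 MW2[OF w(1)] by (subst is_path_Cons) auto
    moreover have "E x y \<longleftrightarrow> x = f \<and> y = w" if "x \<in> set ?A" "y \<in> set (w # g # M2)" for x y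
      using that no[of x y] MW1[of x w] w ew(1) g' f' M(3) sub1 disj by auto
    ultimately have "is_path V E (?A @ w # g # M2)"
      using A w WN0 disj by (subst is_path_append) auto
    moreover have "E z y \<longleftrightarrow> y = hd (?A @ w # g # M2) \<or> y = last (?A @ w # g # M2)"
      if "y \<in> set (?A @ w # g # M2)" for y
    proof -
      have *: "hd (?A @ w # g # M2) = e" "last (?A @ w # g # M2) = last (g # M2)" by simp_all
      have "e \<in> set ?A" by simp
      then have "e \<noteq> w" "w \<noteq> last (g # M2)" "e \<notin> set (g # M2)" "last (g # M2) \<notin> set ?A"
        using WN0 w(1) lastN disj by auto
      moreover have "y = w \<or> y \<in> set ?A \<or> y \<in> set (g # M2)" using that by auto
      ultimately show ?thesis using zA[of y] zC[of y] ew(2) unfolding * by metis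
    qed
    moreover have "z \<notin> set (?A @ w # g # M2)" using z w(1) by (auto simp: setN)
    ultimately have "odd (length (?A @ w # g # M2))"
      using z(1) by (intro odd_length_path(1)[of _ z]) simp_all
    then show False using par by simp
  qed
qed

end

section \<open>Paths linking the two long sectors of a line wheel\<close>

lemma set_tl_distinct: "distinct xs \<Longrightarrow> set (tl xs) = set xs - {hd xs}"
  by (cases xs) auto

text \<open>
  With \<open>a = hd P\<close>, \<open>d = last P\<close>, \<open>b = hd Q\<close>, \<open>c = last Q\<close>, the assumptions are invariant under
  reversing both paths and under exchanging them, so each claim below yields four.
\<close>

locale line_wheel_paths = square_prism_odd_hole_free V E
  for V :: "'a set" and E +
  fixes v :: 'a and P Q :: "'a list"
  assumes v: "v \<in> V" "v \<notin> set P" "v \<notin> set Q"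
    and P: "is_path V E P" "length P \<ge> 3"
    and Q: "is_path V E Q" "length Q \<ge> 3"
    and disj: "set P \<inter> set Q = {}"
    and vP: "\<And>x. x \<in> set P \<Longrightarrow> E v x \<longleftrightarrow> x = hd P \<or> x = last P"
    and vQ: "\<And>x. x \<in> set Q \<Longrightarrow> E v x \<longleftrightarrow> x = hd Q \<or> x = last Q"
    and PQ: "\<And>x y. x \<in> set P \<Longrightarrow> y \<in> set Q \<Longrightarrow>
      E x y \<longleftrightarrow> x = hd P \<and> y = hd Q \<or> x = last P \<and> y = last Q"
begin

lemma ne [simp]: "P \<noteq> []" "Q \<noteq> []"
  using P Q by auto

lemma ends_in: "hd P \<in> set P" "last P \<in> set P" "hd Q \<in> set Q" "last Q \<in> set Q"
  by simp_all

lemma ends_neq: "hd P \<noteq> last P" "hd Q \<noteq> last Q" "\<not> E (hd P) (last P)" "\<not> E (hd Q) (last Q)"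
  using is_path_ends[OF P] is_path_ends[OF Q] by simp_all

lemma QP: "x \<in> set Q \<Longrightarrow> y \<in> set P \<Longrightarrow>
  E x y \<longleftrightarrow> y = hd P \<and> x = hd Q \<or> y = last P \<and> x = last Q"
  by (subst E_sym) (rule PQ)

lemma PQ_neq: "x \<in> set P \<Longrightarrow> y \<in> set Q \<Longrightarrow> x \<noteq> y"
  using disj by blast

lemma set_tl_P: "set (tl P) = set P - {hd P}"
  using P(1) by (intro set_tl_distinct) (simp add: is_path_def)

lemma odd_length_P: "odd (length P)"
  by (rule odd_length_path(1)[OF P v(1,2) vP])

lemma reversed: "line_wheel_paths V E v (rev P) (rev Q)"
proof unfold_locales
  fix x y assume "x \<in> set (rev P)" "y \<in> set (rev Q)"
  then show "E x y \<longleftrightarrow> x = hd (rev P) \<and> y = hd (rev Q) \<or> x = last (rev P) \<and> y = last (rev Q)"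
    using PQ[of x y] by (simp add: hd_rev last_rev disj_commute)
qed (use v P Q disj in \<open>simp_all add: vP vQ hd_rev last_rev disj_commute\<close>)

lemma swapped: "line_wheel_paths V E v Q P"
proof unfold_locales
  fix x y assume "x \<in> set Q" "y \<in> set P"
  then show "E x y \<longleftrightarrow> x = hd Q \<and> y = hd P \<or> x = last Q \<and> y = last P"
    using QP[of x y] by blast
qed (use v P Q disj in \<open>simp_all add: vP vQ Int_commute\<close>)

end

text \<open>Take the first element \<open>y\<close> of \<open>Y\<close> satisfying \<open>C\<close>,
  then the last element before it satisfying \<open>A\<close>. Neither property recurs strictly
  between them.\<close>

lemma exists_gap_aux:
  assumes "A x" "\<exists>y\<in>set Y. C y" "\<And>u. u \<in> set (x # Y) \<Longrightarrow> \<not> (A u \<and> C u)"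
  shows "\<exists>X S Z. x # Y = X @ S @ Z \<and> S \<noteq> [] \<and> (\<forall>u\<in>set S. (A u \<longleftrightarrow> u = hd S) \<and> (C u \<longleftrightarrow> u = last S))"
proof -
  obtain Y1 y Y2 where Y: "Y = Y1 @ y # Y2" "C y" "\<forall>u\<in>set Y1. \<not> C u"
    using split_list_first_prop[OF assms(2)] by blast
  have "\<exists>u\<in>set (x # Y1). A u" using assms(1) by simp
  then obtain X x' Z where X: "x # Y1 = X @ x' # Z" "A x'" "\<forall>u\<in>set Z. \<not> A u"
    using split_list_last_prop by metis
  let ?S = "x' # Z @ [y]"
  have "x # Y = X @ ?S @ Y2" using X(1) Y(1) by (metis append.assoc append_Cons append_Nil)
  moreover have "set Z \<subseteq> set (x # Y1)" "x' \<in> set (x # Y1)" unfolding X(1) by auto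
  then have "set Z \<subseteq> set Y1 \<union> {x}" "x' \<in> set Y1 \<union> {x}" by auto
  then have "\<not> C u" if "u \<in> set Z" for u
    using that Y(3) assms(1) assms(3)[of x] \<open>set Z \<subseteq> set Y1 \<union> {x}\<close> by auto
  moreover have "\<not> A y" "\<not> C x'"
    using assms(3)[of y] assms(3)[of x'] X(2) Y \<open>x' \<in> set Y1 \<union> {x}\<close> by auto
  ultimately show ?thesis
    using X(2,3) Y(2) by (intro exI[of _ X] exI[of _ ?S] exI[of _ Y2]) auto
qed

text \<open>The two alternatives record which of the properties is met first along \<open>R\<close>;
  they become the straight and the crossing case below.\<close>

lemma exists_gap:
  assumes "\<exists>x\<in>set R. A x" "\<exists>y\<in>set R. C y" and no: "\<And>u. u \<in> set R \<Longrightarrow> \<not> (A u \<and> C u)"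
  obtains X S Y where "R = X @ S @ Y" "S \<noteq> []"
    "(\<forall>u\<in>set S. (A u \<longleftrightarrow> u = hd S) \<and> (C u \<longleftrightarrow> u = last S)) \<or>
     (\<forall>u\<in>set S. (C u \<longleftrightarrow> u = hd S) \<and> (A u \<longleftrightarrow> u = last S))"
proof -
  have "\<exists>x\<in>set R. A x \<or> C x" using assms(1) by blast
  then obtain X x Y where R: "R = X @ x # Y" "A x \<or> C x" "\<forall>u\<in>set X. \<not> (A u \<or> C u)"
    using split_list_first_prop[of R "\<lambda>x. A x \<or> C x"] by blast
  have no': "\<not> (A u \<and> C u)" if "u \<in> set (x # Y)" for u
    using no[of u] that R(1) by auto
  consider "A x" "\<exists>y\<in>set Y. C y" | "C x" "\<exists>y\<in>set Y. A y"
    using R assms(1,2) no'[of x] by auto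
  then show thesis
  proof cases
    case 1
    from exists_gap_aux[OF this no'] obtain X' S Z where "x # Y = X' @ S @ Z" "S \<noteq> []"
      "\<forall>u\<in>set S. (A u \<longleftrightarrow> u = hd S) \<and> (C u \<longleftrightarrow> u = last S)" by blast
    then show thesis using that[of "X @ X'" S Z] R(1) by simp
  next
    case 2
    have no'': "\<not> (C u \<and> A u)" if "u \<in> set (x # Y)" for u
      using no'[OF that] by blast
    from exists_gap_aux[OF 2 no''] obtain X' S Z where "x # Y = X' @ S @ Z" "S \<noteq> []"
      "\<forall>u\<in>set S. (C u \<longleftrightarrow> u = hd S) \<and> (A u \<longleftrightarrow> u = last S)" by blast
    then show thesis using that[of "X @ X'" S Z] R(1) by simp
  qed
qed

section \<open>Gaps between neighbours of \<open>hd P\<close> and of \<open>last Q\<close>\<close>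

context line_wheel_paths
begin

text \<open>The cycle \<open>v\<close>, \<open>hd P\<close>, \<open>S\<close>, \<open>last Q\<close>
  is a hole, hence even; a one-vertex \<open>S\<close> would make it a square.\<close>

lemma odd_length_gap:
  assumes S: "is_path V E S" "set S \<inter> set P = {}" "set S \<inter> set Q = {}"
    and vS: "v \<notin> set S" "\<And>x. x \<in> set S \<Longrightarrow> \<not> E v x"
    and aS: "\<And>x. x \<in> set S \<Longrightarrow> E x (hd P) \<longleftrightarrow> x = hd S"
    and cS: "\<And>x. x \<in> set S \<Longrightarrow> E x (last Q) \<longleftrightarrow> x = last S"
  shows "odd (length S)" "length S \<ge> 3"
proof -
  have ne': "S \<noteq> []" using S by (auto simp: is_path_def)
  have V': "hd P \<in> V" "last Q \<in> V" using P Q ends_in by (auto simp: is_path_def)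
  have ac: "\<not> E (hd P) (last Q)" "hd P \<noteq> last Q" "v \<noteq> hd P" "v \<noteq> last Q"
    using PQ[OF ends_in(1,4)] PQ_neq[OF ends_in(1,4)] ends_neq ends_in v by auto
  have nS: "hd P \<notin> set S" "last Q \<notin> set S" using S(2,3) ends_in by auto
  have aS': "E (hd P) x \<longleftrightarrow> x = hd S" if "x \<in> set S" for x
    using aS[OF that] by (subst E_sym)
  have "is_path V E (S @ [last Q])"
    using S ne' V' nS cS by (subst is_path_append) auto
  then have path: "is_path V E (hd P # S @ [last Q])"
    using V' nS aS' ac ne' by (subst is_path_Cons) auto
  have "E v y \<longleftrightarrow> y = hd P \<or> y = last Q" if "y \<in> set (hd P # S @ [last Q])" for y
    using that vS(2)[of y] vP[OF ends_in(1)] vQ[OF ends_in(4)] nS by auto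
  moreover have "v \<notin> set (hd P # S @ [last Q])" "length (hd P # S @ [last Q]) \<ge> 3"
    using ac vS ne' by (auto simp: Suc_le_eq numeral_3_eq_3)
  ultimately have "odd (length (hd P # S @ [last Q]))" "length (hd P # S @ [last Q]) \<noteq> 3"
    using odd_length_path[OF path _ v(1)] by simp_all
  then show "odd (length S)" "length S \<ge> 3"
    by (simp_all) presburger
qed

text \<open>Otherwise \<open>hd P\<close>, \<open>S\<close>, \<open>last Q\<close> and the rest of
  \<open>P\<close> backwards form a hole. Its length is the sum of the odd lengths of
  \<open>S\<close> and \<open>P\<close> plus one, so it is odd.\<close>

lemma gap_meets_P:
  assumes S: "is_path V E S" "set S \<inter> set P = {}" "set S \<inter> set Q = {}"
    and vS: "v \<notin> set S" "\<And>x. x \<in> set S \<Longrightarrow> \<not> E v x"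
    and aS: "\<And>x. x \<in> set S \<Longrightarrow> E x (hd P) \<longleftrightarrow> x = hd S"
    and cS: "\<And>x. x \<in> set S \<Longrightarrow> E x (last Q) \<longleftrightarrow> x = last S"
    and PS: "\<And>x y. x \<in> set S \<Longrightarrow> y \<in> set P \<Longrightarrow> E x y \<Longrightarrow> y = hd P"
  shows False
proof -
  note len = odd_length_gap[OF S vS aS cS]
  have ne': "S \<noteq> []" using S by (auto simp: is_path_def)
  obtain M where M: "P = hd P # M" "M \<noteq> []"
    using P(2) that[of "tl P"] by (cases P; cases "tl P") auto
  have pM: "is_path V E M" and aM: "hd P \<notin> set M" "hd P \<in> V"
    and adjM: "\<And>y. y \<in> set M \<Longrightarrow> E (hd P) y \<longleftrightarrow> y = hd M"
    using P(1) is_path_Cons[OF M(2), of "hd P"] M(1) by auto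
  have lM: "last M = last P" using M by (metis last_ConsR)
  have setP: "set P = insert (hd P) (set M)" using M(1) by (metis list.simps(15))
  have c: "last Q \<in> V" "last Q \<notin> set M" "last Q \<notin> set S" "hd P \<noteq> last Q" "hd P \<notin> set S"
    using Q S ends_in disj setP by (auto simp: is_path_def)
  have "E (last Q) y \<longleftrightarrow> y = last M" if "y \<in> set M" for y
    using QP[OF ends_in(4), of y] that setP ends_neq lM by auto
  then have path1: "is_path V E (last Q # rev M)"
    using pM c M(2) by (subst is_path_Cons) (auto simp: hd_rev)
  have "E x y \<longleftrightarrow> x = last S \<and> y = last Q" if "x \<in> set S" "y \<in> set (last Q # rev M)" for x y
  proof (cases "y = last Q")
    case True
    then show ?thesis using cS[OF that(1)] by simp
  next
    case False
    then have "y \<in> set M" using that(2) by simp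
    with False show ?thesis using PS[OF that(1), of y] aM(1) setP by auto
  qed
  moreover have "set S \<inter> set (last Q # rev M) = {}" using S(2) setP c by auto
  ultimately have path: "is_path V E (S @ last Q # rev M)"
    using S(1) ne' path1 by (subst is_path_append) simp_all
  have hl: "hd (S @ last Q # rev M) = hd S" "last (S @ last Q # rev M) = hd M"
    using ne' M(2) by (simp_all add: last_rev)
  have "E (hd P) y \<longleftrightarrow> y = hd S \<or> y = hd M" if y: "y \<in> set (S @ last Q # rev M)" for y
  proof -
    consider "y \<in> set S" "y \<notin> set M" | "y = last Q" "y \<notin> set M" "y \<notin> set S" | "y \<in> set M" "y \<notin> set S"
      using y S(2) setP c by auto
    then show ?thesis
    proof cases
      case 1
      then show ?thesis using aS[of y] E_sym[of y "hd P"] M(2) by auto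
    next
      case 2
      then show ?thesis using PQ[OF ends_in(1,4)] ends_neq M(2) ne' by auto
    next
      case 3
      then show ?thesis using adjM[of y] ne' by auto
    qed
  qed
  moreover have "hd P \<notin> set (S @ last Q # rev M)" using c aM by simp
  moreover have "length (S @ last Q # rev M) \<ge> 3" using len by simp
  ultimately have "odd (length (S @ last Q # rev M))"
    using odd_length_path(1)[OF path _ aM(2)] unfolding hl by blast
  moreover have "length P = Suc (length M)" using M(1) by (metis length_Cons)
  ultimately show False using len(1) odd_length_P by simp
qed


end

section \<open>A link anticomplete to \<open>v\<close> that attaches only at its ends\<close>

locale attached_path = line_wheel_paths V E v P Q
  for V :: "'a set" and E v P Q +
  fixes R :: "'a list"
  assumes R: "is_path V E R" "set R \<inter> set P = {}" "set R \<inter> set Q = {}" "v \<notin> set R"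
    and vR: "\<And>x. x \<in> set R \<Longrightarrow> \<not> E v x"
    and attP: "\<And>x y. x \<in> set R \<Longrightarrow> y \<in> set P \<Longrightarrow> E x y \<Longrightarrow> y \<noteq> hd P \<Longrightarrow> x = hd R"
    and exP: "\<exists>y\<in>set P. y \<noteq> hd P \<and> E (hd R) y"
    and attQ: "\<And>x y. x \<in> set R \<Longrightarrow> y \<in> set Q \<Longrightarrow> E x y \<Longrightarrow> y \<noteq> last Q \<Longrightarrow> x = last R"
    and exQ: "\<exists>y\<in>set Q. y \<noteq> last Q \<and> E (last R) y"
begin

lemma Rne [simp]: "R \<noteq> []"
  using R by (auto simp: is_path_def)

lemma R_ends: "hd R \<in> set R" "last R \<in> set R"
  by simp_all

lemma inV: "x \<in> set R \<Longrightarrow> x \<in> V" "x \<in> set P \<Longrightarrow> x \<in> V" "x \<in> set Q \<Longrightarrow> x \<in> V"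
  using R P Q by (auto simp: is_path_def)

lemma R_neq: "x \<in> set R \<Longrightarrow> y \<in> set P \<Longrightarrow> x \<noteq> y" "x \<in> set R \<Longrightarrow> y \<in> set Q \<Longrightarrow> x \<noteq> y"
  using R by auto

text \<open>The symmetry that survives the choice of \<open>R\<close>: \<open>hd P\<close> and
  \<open>last Q\<close> trade places, and so do the two ends of \<open>R\<close>. Claims about one
  end thereby transfer to the other.\<close>

lemma flipped: "attached_path V E v (rev Q) (rev P) (rev R)"
proof -
  interpret sw: line_wheel_paths V E v Q P by (rule swapped)
  interpret rv: line_wheel_paths V E v "rev Q" "rev P" by (rule sw.reversed)
  show ?thesis
  proof unfold_locales
    show "\<exists>y\<in>set (rev Q). y \<noteq> hd (rev Q) \<and> E (hd (rev R)) y"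
      using exQ by (simp add: hd_rev)
    show "\<exists>y\<in>set (rev P). y \<noteq> last (rev P) \<and> E (last (rev R)) y"
      using exP by (simp add: last_rev)
  qed (use R vR attP attQ in \<open>simp_all add: hd_rev last_rev\<close>)
qed

text \<open>Such a vertex would be a gap of length one; with \<open>v\<close>, \<open>hd P\<close>
  and \<open>last Q\<close> it spans a square.\<close>

lemma not_both:
  assumes "x \<in> set R"
  shows "\<not> (E x (hd P) \<and> E x (last Q))"
proof
  assume "E x (hd P) \<and> E x (last Q)"
  then have "length [x] \<ge> 3"
    using assms R vR inV by (intro odd_length_gap(2)) auto
  then show False by simp
qed

text \<open>Otherwise \<open>no_attachment\<close> applies to the hole through \<open>v\<close> and
  \<open>P\<close>, with triangle \<open>v\<close>, \<open>hd P\<close>, \<open>hd Q\<close>. The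
  attached path follows \<open>Q\<close> from \<open>hd Q\<close> to the first neighbour
  \<open>q\<close> of \<open>last R\<close> and then runs along \<open>R\<close> backwards; it stops
  before \<open>last Q\<close> because \<open>last R\<close> has an earlier neighbour on
  \<open>Q\<close>.\<close>

lemma hd_P_attached: "\<exists>x\<in>set R. E x (hd P)"
proof (rule ccontr)
  assume "\<not> ?thesis"
  then have aR: "\<not> E (hd P) x" if "x \<in> set R" for x
    using that E_sym by blast
  obtain y where y: "y \<in> set Q" "y \<noteq> last Q" "E (last R) y" using exQ by blast
  then obtain Q1 q Q2 where q: "Q = Q1 @ q # Q2" "E (last R) q" "\<forall>u\<in>set Q1. \<not> E (last R) u"
    using split_list_first_prop[of Q "E (last R)"] by blast
  have "Q2 \<noteq> []" using y q by auto
  then have cq: "last Q \<in> set Q2" using q(1) by simp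
  have dQ: "distinct Q" using Q by (simp add: is_path_def)
  let ?B = "Q1 @ [q]"
  have B: "set ?B \<subseteq> set Q" "last Q \<notin> set ?B" "?B \<noteq> []" "hd ?B = hd Q" "last ?B = q"
    using cq dQ q(1) by (auto simp: hd_append)
  have pB: "is_path V E ?B" using is_path_appendD1[of ?B Q2] Q(1) q(1) by simp
  have BR: "E x y \<longleftrightarrow> x = q \<and> y = last R" if x: "x \<in> set ?B" and y: "y \<in> set R" for x y
  proof -
    have xQ: "x \<in> set Q" "x \<noteq> last Q" using x B by auto
    have "E y x \<longleftrightarrow> x = q \<and> y = last R"
    proof
      assume "E y x"
      then have "y = last R" using attQ[OF y xQ(1)] xQ(2) by blast
      then show "x = q \<and> y = last R" using \<open>E y x\<close> q(3) x by auto
    qed (use q(2) in blast)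
    then show ?thesis by (subst E_sym)
  qed
  let ?W = "?B @ rev R"
  have W: "is_path V E ?W"
    using pB R(1) BR B R(3) by (subst is_path_append) (auto simp: hd_rev)
  have hW: "hd ?W = hd Q" "last ?W = hd R"
    using hd_append2[OF B(3), of "rev R"] B(4) by (simp_all only: last_rev last_append) simp
  have inW: "x \<in> set ?W \<Longrightarrow> x \<in> set Q \<and> x \<noteq> last Q \<or> x \<in> set R" for x using B by auto
  have RQ: "x \<in> set R \<Longrightarrow> x \<noteq> hd Q" for x using R_neq(2) ends_in by blast
  show False
  proof (rule no_attachment[OF P v(1,2) _ vP W])
    show "v \<notin> set ?W" using B v R by auto
    show "2 \<le> length ?W" by (cases R) auto
    show "set ?W \<inter> set P = {}" using inW R_neq(1) PQ_neq by blast
    show "\<exists>y\<in>set (tl P). E (last ?W) y" unfolding hW set_tl_P using exP by blast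
  next
    fix x assume "x \<in> set ?W"
    then show "E v x \<longleftrightarrow> x = hd ?W" "E (hd P) x \<longleftrightarrow> x = hd ?W"
      unfolding hW using inW[of x] RQ[of x] vQ[of x] vR[of x] aR[of x] PQ[OF ends_in(1), of x]
        ends_neq(1) by auto
  next
    fix x y assume "x \<in> set ?W" "y \<in> set (tl P)" "E x y"
    then show "x = last ?W"
      unfolding hW set_tl_P using inW[of x] QP[of x y] attP[of x y] by auto
  qed
qed

text \<open>A gap missing \<open>hd R\<close> has no neighbour on \<open>P\<close> except
  \<open>hd P\<close>, against \<open>gap_meets_P\<close>; a gap missing \<open>last R\<close> is
  the same situation after \<open>flipped\<close>.\<close>

lemma gap_meets_ends:
  assumes S: "is_path V E S" "set S \<subseteq> set R"
    and aS: "\<And>x. x \<in> set S \<Longrightarrow> E x (hd P) \<longleftrightarrow> x = hd S"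
    and cS: "\<And>x. x \<in> set S \<Longrightarrow> E x (last Q) \<longleftrightarrow> x = last S"
  shows "hd R \<in> set S \<and> last R \<in> set S"
proof (rule ccontr)
  have Sne: "S \<noteq> []" using S by (auto simp: is_path_def)
  have avoid: "set S \<inter> set P = {}" "set S \<inter> set Q = {}" "v \<notin> set S" "\<And>x. x \<in> set S \<Longrightarrow> \<not> E v x"
    using S(2) R vR by auto
  interpret fl: attached_path V E v "rev Q" "rev P" "rev R" by (rule flipped)
  assume "\<not> ?thesis"
  then consider "hd R \<notin> set S" | "last R \<notin> set S" by blast
  then show False
  proof cases
    case 1
    show False
      by (rule gap_meets_P[OF S(1) avoid aS cS]) (use 1 S(2) attP in blast)+
  next
    case 2
    have "y = hd (rev Q)" if "x \<in> set (rev S)" "y \<in> set (rev Q)" "E x y" for x y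
      using that 2 S(2) attQ[of x y] by (auto simp: hd_rev)
    then show False
      using fl.gap_meets_P[of "rev S"] S(1) avoid aS cS Sne by (simp add: hd_rev last_rev)
  qed
qed

text \<open>
  The hole runs from \<open>last P\<close> along \<open>P\<close> to the last neighbour of \<open>hd R\<close>, then along \<open>R\<close>, and
  closes through \<open>last Q\<close>; the attached path is \<open>v, hd P\<close>.
\<close>

lemma not_straight:
  assumes aR: "\<And>x. x \<in> set R \<Longrightarrow> E x (hd P) \<longleftrightarrow> x = hd R"
    and cR: "\<And>x. x \<in> set R \<Longrightarrow> E x (last Q) \<longleftrightarrow> x = last R"
  shows False
proof -
  have len: "length R \<ge> 3" by (rule odd_length_gap(2)[OF R vR aR cR])
  obtain y where y: "y \<in> set P" "y \<noteq> hd P" "E (hd R) y" using exP by blast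
  then obtain P1 p P2 where p: "P = P1 @ p # P2" "E (hd R) p" "\<forall>u\<in>set P2. \<not> E (hd R) u"
    using split_list_last_prop[of P "E (hd R)"] by blast
  have "P1 \<noteq> []" using y p by auto
  then have ap: "hd P \<in> set P1" using p(1) by simp
  have dP: "distinct P" using P by (simp add: is_path_def)
  let ?D = "p # P2"
  have D: "set ?D \<subseteq> set P" "hd P \<notin> set ?D" "last ?D = last P"
    using ap dP p(1) by auto
  have pD: "is_path V E ?D" using is_path_appendD2[of P1 ?D] P(1) p(1) by simp
  then have prD: "is_path V E (rev ?D)" by (simp only: is_path_rev)
  have DR: "E x y \<longleftrightarrow> x = p \<and> y = hd R" if x: "x \<in> set ?D" and y: "y \<in> set R" for x y
  proof -
    have xP: "x \<in> set P" "x \<noteq> hd P" using x D by auto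
    have "E y x \<longleftrightarrow> x = p \<and> y = hd R"
    proof
      assume "E y x"
      then have "y = hd R" using attP[OF y xP(1)] xP(2) by blast
      then show "x = p \<and> y = hd R" using \<open>E y x\<close> p(3) x by auto
    qed (use p(2) in blast)
    then show ?thesis by (subst E_sym)
  qed
  let ?N = "rev ?D @ R"
  have DRd: "set ?D \<inter> set R = {}" using D R(2) by blast
  have N: "is_path V E ?N"
    using prD R(1) DR DRd by (subst is_path_append) auto
  have hlD: "hd (rev ?D) = last P" using D(3) by (simp only: hd_rev)
  have hN: "hd ?N = last P" "last ?N = last R"
    using hlD by (simp_all del: rev.simps add: hd_append)
  have inN: "set ?N = set ?D \<union> set R" by auto
  have dN: "distinct ?N" using N by (simp add: is_path_def)
  have setN: "set (tl ?N) = set ?N - {last P}"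
    using set_tl_distinct[OF dN] unfolding hN(1) .
  have lR: "last R \<noteq> last P" using R_neq(1) R_ends ends_in by blast
  have ad: "\<not> E (last P) (hd P)" using ends_neq(3) by (subst E_sym)
  have ca: "\<not> E (last Q) (hd P)" using QP[OF ends_in(4,1)] ends_neq by simp
  have vx: "E v (last P)" "E v (last Q)" "E v (hd P)" using vP vQ ends_in by simp_all
  have hR: "hd R \<noteq> last P" "E (hd P) (hd R)"
    using R_neq(1) R_ends ends_in aR[OF R_ends(1)] E_sym by blast+
  have vne: "v \<noteq> hd P" "v \<noteq> last Q" using v ends_in by auto
  let ?W = "[v, hd P]"
  show False
  \<comment> \<open>The triangle is \<open>last P\<close>, \<open>last Q\<close>, \<open>v\<close>,
    and \<open>hd P\<close> meets the hole at \<open>hd R\<close>.\<close>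
  proof (rule no_attachment[of ?N "last Q" ?W])
    show "is_path V E ?N" by fact
    show "3 \<le> length ?N" using len by simp
    show "last Q \<in> V" using inV ends_in by blast
    show "last Q \<notin> set ?N" unfolding inN using D R_neq(2) PQ_neq ends_in by blast
    show "last Q \<notin> set ?W" using vne PQ_neq[OF ends_in(1,4)] by auto
    show "is_path V E ?W" using v vne vx inV ends_in by (auto simp: is_path_Cons)
    show "2 \<le> length ?W" by simp
    show "set ?W \<inter> set ?N = {}" unfolding inN using D v R ends_in by auto
    show "\<exists>y\<in>set (tl ?N). E (last ?W) y"
      unfolding setN inN using hR R_ends by (intro bexI[of _ "hd R"]) auto
  next
    fix y assume "y \<in> set ?N"
    then consider "y \<in> set ?D" | "y \<in> set R" by auto
    then show "E (last Q) y \<longleftrightarrow> y = hd ?N \<or> y = last ?N"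
    proof cases
      case 1
      then have "y \<in> set P" "y \<noteq> last R" using D DRd R_ends by auto
      then show ?thesis unfolding hN using QP[OF ends_in(4), of y] ends_neq by auto
    next
      case 2
      then have "y \<noteq> last P" using R_neq(1) ends_in by blast
      then show ?thesis unfolding hN using cR[OF 2] E_sym[of "last Q" y] by blast
    qed
  next
    fix x assume "x \<in> set ?W"
    then have "x = v \<or> x = hd P" by simp
    moreover have "E (last Q) v" "E (last P) v" using vx E_sym by blast+
    ultimately show "E (last Q) x \<longleftrightarrow> x = hd ?W" "E (hd ?N) x \<longleftrightarrow> x = hd ?W"
      unfolding hN using ca ad vne by auto
  next
    fix x y assume xy: "x \<in> set ?W" "y \<in> set (tl ?N)" "E x y"
    have "\<not> E v y" using xy(2) vP[of y] vR[of y] D unfolding setN inN by auto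
    then show "x = last ?W" using xy(1,3) by auto
  qed
qed


text \<open>Existence of the edge to \<open>last P\<close> comes from \<open>no_attachment\<close>;
  uniqueness from two holes whose lengths differ in parity. Half of the edges of the final prism are
  thereby determined, and \<open>flipped\<close> gives the others.\<close>

lemma crossing_hd:
  assumes aR: "\<And>x. x \<in> set R \<Longrightarrow> E x (hd P) \<longleftrightarrow> x = last R"
    and cR: "\<And>x. x \<in> set R \<Longrightarrow> E x (last Q) \<longleftrightarrow> x = hd R"
    and hl: "hd R \<noteq> last R" and y: "y \<in> set P"
  shows "E (hd R) y \<longleftrightarrow> y = last P"
proof -
  have dP: "distinct P" using P by (simp add: is_path_def)
  have vne: "v \<noteq> hd P" "v \<noteq> last Q" "v \<noteq> hd R" using v R(4) R_ends(1) ends_in by metis+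
  have vx: "E v (last Q)" "E v (hd P)" "\<not> E v (hd R)" using vQ vP vR ends_in R_ends by simp_all
  have cd: "E (last P) (last Q)" "E (hd P) (hd Q)" using PQ ends_in by simp_all
  have cR': "E (last Q) (hd R)" using cR[OF R_ends(1)] E_sym by blast
  have neq: "hd R \<noteq> last Q" "hd R \<notin> set P" "hd R \<notin> set Q" using R_neq[OF R_ends(1)] ends_in(4) by auto
  have X: "is_path V E [hd R, last Q]"
    using cR' neq inV(1)[OF R_ends(1)] inV(3)[OF ends_in(4)] E_sym[of "hd R" "last Q"]
    by (auto simp: is_path_Cons)
  have d: "E (hd R) (last P)"
  proof (rule ccontr)
    assume n: "\<not> E (hd R) (last P)"
    have hrP: "hd (rev P) = last P" "last (rev P) = hd P" by (simp_all add: hd_rev last_rev)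
    have set_tl: "set (tl (rev P)) = set P - {last P}"
      using set_tl_distinct[of "rev P"] dP by (simp add: hd_rev)
    \<comment> \<open>The triangle is \<open>v\<close>, \<open>last P\<close>,
      \<open>last Q\<close>; from it \<open>hd R\<close> reaches a vertex of \<open>P\<close> other
      than \<open>last P\<close>.\<close>
    let ?W = "[last Q, hd R]"
    show False
    proof (rule no_attachment[of "rev P" v ?W])
      show "is_path V E ?W" using X is_path_rev[of ?W] by simp
      show "E v y \<longleftrightarrow> y = hd (rev P) \<or> y = last (rev P)" if "y \<in> set (rev P)" for y
        using vP[of y] that unfolding hrP by auto
      show "v \<notin> set ?W" using vne by simp
      show "set ?W \<inter> set (rev P) = {}" using neq PQ_neq[OF _ ends_in(4)] by auto
      show "\<exists>y\<in>set (tl (rev P)). E (last ?W) y" using exP n unfolding set_tl by auto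
      fix x assume "x \<in> set ?W"
      then have x: "x = last Q \<or> x = hd R" by simp
      have n': "\<not> E (last P) (hd R)" using n by (subst E_sym)
      show "E v x \<longleftrightarrow> x = hd ?W" "E (hd (rev P)) x \<longleftrightarrow> x = hd ?W"
        unfolding hrP using x vx cd n' neq by auto
      fix y assume "y \<in> set (tl (rev P))" "E x y"
      then show "x = last ?W" using x QP[OF ends_in(4), of y] ends_neq unfolding set_tl by auto
    qed (use P v in simp_all)
  qed
  have "y = last P" if Ey: "E (hd R) y"
  proof (rule ccontr)
    assume yd: "y \<noteq> last P"
    obtain P1 p P2 where p: "P = P1 @ p # P2" "E (hd R) p" "\<forall>u\<in>set P1. \<not> E (hd R) u"
      using split_list_first_prop[of P "E (hd R)"] y Ey by blast
    have "P2 \<noteq> []" using p y yd Ey by auto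
    then have "last P \<in> set P2" using p(1) by simp
    let ?D = "P1 @ [p]"
    have D: "set ?D \<subseteq> set P" "last P \<notin> set ?D" "?D \<noteq> []" "hd ?D = hd P" "last ?D = p"
      using \<open>last P \<in> set P2\<close> dP p(1) by (auto simp: hd_append)
    have D': "E (hd R) x \<longleftrightarrow> x = p" if "x \<in> set ?D" for x using that p(2,3) by auto
    have pD: "is_path V E ?D" using is_path_appendD1[of ?D P2] P(1) p(1) by simp
    have dh: "x \<in> set ?D \<Longrightarrow> x \<in> set P \<and> x \<noteq> last P \<and> x \<noteq> hd R \<and> x \<noteq> last Q" for x
      using D neq PQ_neq[OF _ ends_in(4)] by blast
    \<comment> \<open>Closed by \<open>v\<close>, this path shows that \<open>?D\<close> has odd
      length.\<close>
    let ?N1 = "?D @ [hd R, last Q]"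
    have "E x y \<longleftrightarrow> x = p \<and> y = hd R" if "x \<in> set ?D" "y \<in> set [hd R, last Q]" for x y
    proof -
      have "E x (hd R) \<longleftrightarrow> x = p" using D'[OF that(1)] by (subst E_sym)
      moreover have "\<not> E x (last Q)" using dh[OF that(1)] PQ[of x "last Q"] ends_in ends_neq by auto
      ultimately show ?thesis using that(2) neq by auto
    qed
    then have N1: "is_path V E ?N1"
      using pD X D(5) dh by (subst is_path_append) auto
    have hN1: "hd ?N1 = hd P" "last ?N1 = last Q" using D(4) hd_append2[OF D(3)] by (simp_all)
    have "odd (length ?N1)"
    proof (rule odd_length_path(1)[OF N1 _ v(1)])
      show "v \<notin> set ?N1" using dh v vne by auto
      fix x assume "x \<in> set ?N1"
      then consider "x \<in> set ?D" | "x = hd R" | "x = last Q" by auto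
      then show "E v x \<longleftrightarrow> x = hd ?N1 \<or> x = last ?N1"
      proof cases
        case 1
        then show ?thesis unfolding hN1 using dh[OF 1] vP[of x] by simp
      next
        case 2
        then show ?thesis unfolding hN1 using vx neq ends_in(1) by auto
      next
        case 3
        then show ?thesis unfolding hN1 using vx by simp
      qed
    qed simp
    moreover have "odd (length (rev Q @ ?D))"
    proof -
      \<comment> \<open>Closed by \<open>hd R\<close>, this path shows that \<open>Q\<close> and
        \<open>?D\<close> have lengths of different parity. As \<open>Q\<close> is odd,
        \<open>?D\<close> would be even.\<close>
      let ?N2 = "rev Q @ ?D"
      have "E x y \<longleftrightarrow> x = hd Q \<and> y = hd P" if "x \<in> set Q" "y \<in> set ?D" for x y
        using QP[OF that(1), of y] dh[OF that(2)] by auto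
      then have N2: "is_path V E ?N2"
        using pD Q(1) D disj by (subst is_path_append) (auto simp: last_rev)
      have hN2: "hd ?N2 = last Q" "last ?N2 = p" by (simp_all add: hd_rev)
      show ?thesis
      proof (rule odd_length_path(1)[OF N2])
        show "hd R \<in> V" "hd R \<notin> set ?N2" using inV R_ends dh neq by auto
        show "3 \<le> length ?N2" using Q(2) by simp
        fix x assume "x \<in> set ?N2"
        then consider "x \<in> set ?D" | "x \<in> set Q" "x \<noteq> p" using D(1) PQ_neq by auto
        then show "E (hd R) x \<longleftrightarrow> x = hd ?N2 \<or> x = last ?N2"
        proof cases
          case 1
          then show ?thesis unfolding hN2 using D'[OF 1] dh[OF 1] by simp
        next
          case 2
          then show ?thesis unfolding hN2
            using attQ[OF R_ends(1), of x] hl cR[OF R_ends(1)] by blast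
        qed
      qed
    qed
    moreover have "odd (length Q)" by (rule odd_length_path(1)[OF Q v(1,3) vQ])
    ultimately show False by simp
  qed
  with d show ?thesis by blast
qed

text \<open>The prism has triangles \<open>last P\<close>, \<open>hd R\<close>,
  \<open>last Q\<close> and \<open>hd P\<close>, \<open>last R\<close>, \<open>hd Q\<close>, joined
  by the three paths \<open>P\<close>, \<open>R\<close>, \<open>Q\<close>.\<close>

lemma not_crossing:
  assumes aR: "\<And>x. x \<in> set R \<Longrightarrow> E x (hd P) \<longleftrightarrow> x = last R"
    and cR: "\<And>x. x \<in> set R \<Longrightarrow> E x (last Q) \<longleftrightarrow> x = hd R"
  shows False
proof -
  interpret fl: attached_path V E v "rev Q" "rev P" "rev R" by (rule flipped)
  have "length (rev R) \<ge> 3"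
    using R vR aR cR by (intro odd_length_gap(2)) (auto simp: hd_rev last_rev)
  then have hl: "hd R \<noteq> last R" using is_path_ends(1)[OF R(1)] by simp
  have 1: "E (hd R) y \<longleftrightarrow> y = last P" if "y \<in> set P" for y
    using crossing_hd[OF aR cR hl that] .
  have 2: "E (last R) y \<longleftrightarrow> y = hd Q" if "y \<in> set Q" for y
    using fl.crossing_hd[of y] aR cR hl that by (simp add: hd_rev last_rev)
  show False
  proof (rule no_prism[of "rev P" R "rev Q"])
    fix x y assume x: "x \<in> set (rev P)" and y: "y \<in> set R"
    have "E y x \<longleftrightarrow> x = last P \<and> y = hd R \<or> x = hd P \<and> y = last R"
    proof (cases "x = hd P")
      case True
      then show ?thesis using aR[OF y] ends_neq by auto
    next
      case False
      then show ?thesis using attP[OF y, of x] 1[of x] x by auto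
    qed
    then have "E x y \<longleftrightarrow> x = last P \<and> y = hd R \<or> x = hd P \<and> y = last R" by (subst E_sym)
    then show "E x y \<longleftrightarrow> x = hd (rev P) \<and> y = hd R \<or> x = last (rev P) \<and> y = last R"
      by (simp add: hd_rev last_rev)
  next
    fix x y assume x: "x \<in> set R" and y: "y \<in> set (rev Q)"
    have "E x y \<longleftrightarrow> y = last Q \<and> x = hd R \<or> y = hd Q \<and> x = last R"
    proof (cases "y = last Q")
      case True
      then show ?thesis using cR[OF x] ends_neq by auto
    next
      case False
      then show ?thesis using attQ[OF x, of y] 2[of y] y by auto
    qed
    then show "E x y \<longleftrightarrow> x = hd R \<and> y = hd (rev Q) \<or> x = last R \<and> y = last (rev Q)"
      by (auto simp: hd_rev last_rev)
  next
    fix x y assume "x \<in> set (rev P)" "y \<in> set (rev Q)"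
    then show "E x y \<longleftrightarrow> x = hd (rev P) \<and> y = hd (rev Q) \<or> x = last (rev P) \<and> y = last (rev Q)"
      using PQ[of x y] by (auto simp: hd_rev last_rev)
  qed (use P Q R disj ends_neq hl in \<open>auto simp: hd_rev last_rev\<close>)
qed

lemma contradiction: False
proof -
  interpret fl: attached_path V E v "rev Q" "rev P" "rev R" by (rule flipped)
  have "\<exists>x\<in>set R. E x (last Q)" using fl.hd_P_attached by (simp add: hd_rev)
  with hd_P_attached obtain X S Y where S: "R = X @ S @ Y" "S \<noteq> []"
    "(\<forall>u\<in>set S. (E u (hd P) \<longleftrightarrow> u = hd S) \<and> (E u (last Q) \<longleftrightarrow> u = last S)) \<or>
     (\<forall>u\<in>set S. (E u (last Q) \<longleftrightarrow> u = hd S) \<and> (E u (hd P) \<longleftrightarrow> u = last S))"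
    using exists_gap[of R "\<lambda>u. E u (hd P)" "\<lambda>u. E u (last Q)"] not_both by blast
  have dR: "distinct R" using R by (simp add: is_path_def)
  have pS: "is_path V E S"
    using is_path_appendD1[of S Y] is_path_appendD2[of X "S @ Y"] R(1) S(1,2) by simp
  have sub: "set S \<subseteq> set R" using S(1) by auto
  \<comment> \<open>\<open>S\<close> is a contiguous piece of the repetition-free list
    \<open>R\<close>, so containing both ends forces it to be everything.\<close>
  have full: "S = R" if "hd R \<in> set S \<and> last R \<in> set S"
  proof -
    have "X = []" using that dR S(1) by (cases X) auto
    moreover have "Y = []" using that dR S(1) by (cases Y rule: rev_cases) auto
    ultimately show ?thesis using S(1) by simp
  qed
  from S(3) show False
  proof
    assume *: "\<forall>u\<in>set S. (E u (hd P) \<longleftrightarrow> u = hd S) \<and> (E u (last Q) \<longleftrightarrow> u = last S)"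
    then have "S = R" using gap_meets_ends[OF pS sub] full by blast
    then show False using * not_straight by blast
  next
    assume *: "\<forall>u\<in>set S. (E u (last Q) \<longleftrightarrow> u = hd S) \<and> (E u (hd P) \<longleftrightarrow> u = last S)"
    then have "S = R" using gap_meets_ends[of "rev S"] full pS sub S(2) by (simp add: hd_rev last_rev)
    then show False using * not_crossing by blast
  qed
qed

end

section \<open>Arbitrary links, and the breaking property\<close>

context line_wheel_paths
begin

text \<open>Stated for links that need not be minimal, as \<open>breaks_last\<close> produces such
  ones. Induction on the length takes the place of minimality: an attachment at a wrong vertex
  leaves a shorter suffix or prefix that still links.\<close>

lemma no_link:
  assumes "is_path V E R" "set R \<inter> set P = {}" "set R \<inter> set Q = {}" "v \<notin> set R"
    and "\<forall>x\<in>set R. \<not> E v x" "links E (set P - {hd P}) (set Q - {last Q}) R"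
  shows False
  using assms
proof (induction R rule: length_induct)
  case (1 R)
  have IH: False if "length S < length R" "is_path V E S" "set S \<subseteq> set R"
    "links E (set P - {hd P}) (set Q - {last Q}) S" for S
  proof -
    have "set S \<inter> set P = {}" "set S \<inter> set Q = {}" "v \<notin> set S" "\<forall>x\<in>set S. \<not> E v x"
      using "1.prems" that(3) by auto
    then show False using "1.IH" that by blast
  qed
  have Rne: "R \<noteq> []" using "1.prems"(1) by (auto simp: is_path_def)
  have lR: "\<exists>y\<in>set P - {hd P}. E (hd R) y" "\<exists>y\<in>set Q - {last Q}. E (last R) y"
    using "1.prems"(6) by (auto simp: links_def)
  interpret attached_path V E v P Q R
  proof unfold_locales
    fix x y assume *: "x \<in> set R" "y \<in> set P" "E x y" "y \<noteq> hd P"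
    show "x = hd R"
    proof (rule ccontr)
      assume "x \<noteq> hd R"
      obtain R1 R2 where x: "R = R1 @ x # R2" using *(1) by (auto dest: split_list)
      with \<open>x \<noteq> hd R\<close> have "R1 \<noteq> []" by auto
      then show False
        using IH[of "x # R2"] is_path_appendD2[of R1 "x # R2"] "1.prems"(1) lR(2) *
        by (auto simp: x links_def)
    qed
  next
    fix x y assume *: "x \<in> set R" "y \<in> set Q" "E x y" "y \<noteq> last Q"
    show "x = last R"
    proof (rule ccontr)
      assume "x \<noteq> last R"
      obtain R1 R2 where x: "R = R1 @ x # R2" using *(1) by (auto dest: split_list)
      with \<open>x \<noteq> last R\<close> have "R2 \<noteq> []" by auto
      moreover have "hd (R1 @ [x]) = hd R" by (simp add: x hd_append)
      ultimately show False
        using IH[of "R1 @ [x]"] is_path_appendD1[of "R1 @ [x]" R2] "1.prems"(1) lR(1) *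
        by (auto simp: x links_def)
    qed
  qed (use "1.prems" lR in \<open>auto simp: links_def\<close>)
  show False by (rule contradiction)
qed

lemma path_from_meets_nbhd:
  assumes "path_from V E (set P - {hd P}) (set Q - {last Q}) R" "v \<notin> set R"
  shows "\<exists>x\<in>set R. E v x"
proof (rule ccontr)
  assume no: "\<not> ?thesis"
  \<comment> \<open>\<open>path_from\<close> keeps \<open>R\<close> off the two trimmed paths only;
    the two removed ends are avoided because they are neighbours of \<open>v\<close>.\<close>
  have "hd P \<notin> set R" "last Q \<notin> set R" using no vP vQ ends_in by auto
  then show False
    using assms no unfolding path_from_def by (intro no_link[of R]) auto
qed

text \<open>If a component \<open>D\<close> reached all of the set, a path through \<open>D\<close>
  from \<open>last P\<close> to an inner vertex of \<open>Q\<close> would contain a link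
  anticomplete to \<open>v\<close>.\<close>

lemma breaks_last:
  "breaks V E v ({last P} \<union> interior Q)"
  unfolding breaks_def
proof (intro allI impI notI)
  fix D assume D: "component E (V - cnbhd V E {v}) D" and Y: "{last P} \<union> interior Q \<subseteq> cnbhd V E D"
  define rel where "rel = (\<lambda>S u w. u \<in> S \<and> w \<in> S \<and> E u w)"
  let ?S = "V - cnbhd V E {v}"
  obtain x0 where x0: "x0 \<in> ?S" "D = {y. (rel ?S)\<^sup>*\<^sup>* x0 y}"
    using D by (auto simp: component_def rel_def)
  have "y \<in> ?S" if "(rel ?S)\<^sup>*\<^sup>* x0 y" for y
    using that x0(1) by (induction rule: rtranclp_induct) (auto simp: rel_def)
  then have DS: "D \<subseteq> ?S" using x0(2) by blast
  then have Dv: "x \<in> V" "x \<noteq> v" "\<not> E v x" if "x \<in> D" for x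
    using that E_sym[of v x] by (auto simp: cnbhd_def)
  \<comment> \<open>\<open>?T\<close> is connected, since each added vertex is in \<open>D\<close>
    or has a neighbour in \<open>D\<close>; its vertices off \<open>P\<close> and \<open>Q\<close>
    all lie in \<open>D\<close>.\<close>
  let ?T = "D \<union> ({last P} \<union> interior Q)"
  have sym: "symp (rel ?T)" by (auto simp: symp_def rel_def E_sym)
  have reach0: "(rel ?T)\<^sup>*\<^sup>* x0 y" if "y \<in> D" for y
  proof -
    have "(rel ?S)\<^sup>*\<^sup>* x0 y" using that x0(2) by simp
    then show ?thesis
    proof (induction rule: rtranclp_induct)
      case (step y z)
      then have "y \<in> D" "z \<in> D" using x0(2) by (auto intro: rtranclp.rtrancl_into_rtrancl)
      with step show ?case by (auto simp: rel_def intro: rtranclp.rtrancl_into_rtrancl)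
    qed simp
  qed
  have reach: "(rel ?T)\<^sup>*\<^sup>* x0 y" if "y \<in> {last P} \<union> interior Q" for y
  proof (cases "y \<in> D")
    case False
    moreover have "y \<in> cnbhd V E D" using that Y by blast
    ultimately obtain w where w: "w \<in> D" "E y w" by (auto simp: cnbhd_def)
    then have "rel ?T w y" using that E_sym[of y w] by (auto simp: rel_def)
    then show ?thesis using reach0[OF w(1)] by simp
  qed (rule reach0)
  obtain b1 q Q2 where Q3: "Q = b1 # q # Q2" "Q2 \<noteq> []"
    using Q(2) by (auto simp: numeral_3_eq_3 Suc_le_length_iff)
  have qi: "q \<in> interior Q"
    using Q(1) Q3 by (auto simp: interior_def is_path_def)
  have intQ: "interior Q \<subseteq> set Q - {last Q}" by (auto simp: interior_def)
  have "(rel ?T)\<^sup>*\<^sup>* (last P) x0" using reach[of "last P"] sym by (meson UnCI insertI1 sympD symp_rtranclp)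
  then have "(rel ?T)\<^sup>*\<^sup>* (last P) q" using reach[of q] qi by (meson UnCI rtranclp_trans)
  moreover have "?T \<subseteq> V" using Dv(1) P Q ends_in intQ by (auto simp: is_path_def)
  ultimately obtain xs where xs: "is_path V E xs" "set xs \<subseteq> ?T" "hd xs = last P" "last xs = q"
    using path_of_rtranclp[of ?T "last P" q] unfolding rel_def by blast
  have xs_ne: "xs \<noteq> []" using xs by (auto simp: is_path_def)
  let ?A = "set P - {hd P}" and ?B = "set Q - {last Q}"
  have "last P \<in> ?A" using ends_in ends_neq by auto
  then have "\<exists>x\<in>set xs. x \<in> ?A" using xs(3) xs_ne by (metis hd_in_set)
  \<comment> \<open>Cutting at the last vertex in \<open>?A\<close> and then at the first later
    vertex in \<open>?B\<close> leaves a stretch \<open>X3\<close> that avoids both sets and so lies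
    in \<open>D\<close>.\<close>
  then obtain X1 p X2 where p: "xs = X1 @ p # X2" "p \<in> ?A" "\<forall>u\<in>set X2. u \<notin> ?A"
    using split_list_last_prop[of xs "\<lambda>x. x \<in> ?A"] by blast
  have qB: "q \<in> ?B" using qi intQ by auto
  then have "q \<noteq> p" using p(2) PQ_neq[of p q] by auto
  then have "X2 \<noteq> []" using p(1) xs(4) by auto
  then have "q \<in> set X2" using p(1) xs(4) by auto
  then obtain X3 u X4 where u: "X2 = X3 @ u # X4" "u \<in> ?B" "\<forall>w\<in>set X3. w \<notin> ?B"
    using split_list_first_prop[of X2 "\<lambda>x. x \<in> ?B"] qB by blast
  have X2: "is_path V E (p # X3 @ u # X4)"
    using xs(1) is_path_appendD2[of X1 "p # X2"] by (simp add: p u)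
  \<comment> \<open>The only edges between \<open>P\<close> and \<open>Q\<close> are the two short
    sectors, and each uses \<open>hd P\<close> or \<open>last Q\<close>. Hence \<open>X3\<close> is
    nonempty.\<close>
  have "\<not> E p u" using PQ[of p u] p(2) u(2) by auto
  then have X3: "X3 \<noteq> []" using X2 by (auto simp: is_path_Cons)
  then have pX: "is_path V E (X3 @ u # X4)" "E p (hd X3)"
    using X2 by (auto simp: is_path_Cons)
  then have pX3: "is_path V E X3" "E (last X3) u"
    using X3 by (auto simp: is_path_append)
  have XD: "x \<in> D \<and> x \<notin> ?A \<and> x \<notin> ?B" if "x \<in> set X3" for x
  proof -
    have "x \<in> set xs" using that by (simp add: p(1) u(1))
    then have "x \<in> ?T" using xs(2) by blast
    moreover have "x \<notin> ?A" "x \<notin> ?B" using that p(3) u(1,3) by simp_all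
    ultimately show ?thesis using intQ \<open>last P \<in> ?A\<close> by blast
  qed
  have vac: "E v (hd P)" "E v (last Q)" using vP vQ ends_in by auto
  have avoid: "x \<noteq> v \<and> \<not> E v x \<and> x \<notin> set P \<and> x \<notin> set Q" if "x \<in> set X3" for x
    using XD[OF that] Dv[of x] vac by blast
  show False
    using pX3 pX(2) avoid p(2) u(2) E_sym[of p "hd X3"] by (intro no_link[of X3]) (auto simp: links_def)
qed

end

section \<open>From line wheels to the two paths\<close>

text \<open>Three consecutive neighbours of \<open>v\<close> would give two short sectors sharing
  the middle vertex.\<close>

lemma line_wheel_no_three_consecutive:
  assumes "line_wheel V E hs v" "i < length hs" "E v (hs ! i)" "E v (hs ! (Suc i mod length hs))"
  shows "\<not> E v (hs ! (Suc (Suc i mod length hs) mod length hs))"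
proof
  let ?n = "length hs" and ?j = "Suc i mod length hs"
  assume third: "E v (hs ! (Suc ?j mod ?n))"
  have n: "?n \<ge> 4" using assms(1) by (simp add: line_wheel_def is_wheel_def is_hole_def)
  then have j: "?j < ?n" "?j \<noteq> i" using assms(2) by (auto simp: mod_Suc)
  have s: "(i, 1) \<in> sectors E hs v" "(?j, 1) \<in> sectors E hs v"
    using assms(2-4) third n j by (auto simp: sectors_def)
  then have "segment hs i 1 \<inter> segment hs ?j 1 = {}"
    using assms(1) j(2) unfolding line_wheel_def by fastforce
  moreover have "hs ! ?j \<in> segment hs i 1" unfolding segment_def by (auto intro!: exI[of _ 1])
  moreover have "hs ! ?j \<in> segment hs ?j 1"
    unfolding segment_def using j(1) by (auto intro!: exI[of _ 0])
  ultimately show False by blast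
qed

text \<open>The path could step out of \<open>I\<close> only from its last vertex, where it already
  stops. This locates \<open>P\<close> and \<open>Q\<close> on the hole without assuming them to be
  sublists of \<open>hs\<close>.\<close>

lemma path_confined:
  assumes P: "is_path V E P" and I: "hd P \<in> I"
    and exit: "\<And>x y. x \<in> I \<Longrightarrow> y \<in> set P \<Longrightarrow> y \<notin> I \<Longrightarrow> E x y \<Longrightarrow> x = last P"
  shows "set P \<subseteq> I"
proof -
  have ne: "P \<noteq> []" and d: "distinct P"
    and adj: "\<And>i. Suc i < length P \<Longrightarrow> E (P ! i) (P ! Suc i)"
    using P by (auto simp: is_path_def)
  have "P ! i \<in> I" if "i < length P" for i
    using that
  proof (induction i)
    case 0
    then show ?case using I ne by (simp add: hd_conv_nth)
  next
    case (Suc i)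
    have "P ! i \<noteq> last P"
      using Suc.prems d ne by (simp add: last_conv_nth nth_eq_iff_index_eq)
    then show ?case using exit[of "P ! i" "P ! Suc i"] Suc adj[of i] by auto
  qed
  then show ?thesis by (auto simp: in_set_conv_nth)
qed

lemma length_path_ge_3:
  assumes "is_path V E P" "hd P \<noteq> last P" "\<not> E (hd P) (last P)"
  shows "length P \<ge> 3"
proof (rule ccontr)
  assume "\<not> 3 \<le> length P"
  moreover have "length P \<noteq> 0" using assms(1) by (simp add: is_path_def)
  ultimately have "length P = 1 \<or> length P = 2" by linarith
  then show False
    using assms by (auto simp: length_Suc_conv numeral_2_eq_2 is_path_def All_less_Suc2)
qed

lemma line_wheel_paths_of_line_wheel:
  assumes G: "graph V E" "perfect V E" "C4_free V E" "prism_free V E"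
    and wheel: "line_wheel V E hs v"
    and abcd: "hs ! 0 = a" "hs ! 1 = b" "Suc k < length hs" "hs ! k = c" "hs ! Suc k = d"
    and nb: "{x \<in> set hs. E v x} = {a, b, c, d}"
    and P: "is_path V E P" "hd P = a" "last P = d" "set P \<subseteq> set hs - {b}"
    and Q: "is_path V E Q" "hd Q = b" "last Q = c" "set Q \<subseteq> set hs - {a}"
  shows "line_wheel_paths V E v P Q"
proof -
  interpret square_prism_odd_hole_free V E
    using G perfect_hole_even[OF G(1,2)] by unfold_locales auto
  let ?n = "length hs"
  have hole: "is_hole V E hs" and vV: "v \<in> V" and card3: "card {x \<in> set hs. E v x} \<ge> 3"
    using wheel by (auto simp: line_wheel_def is_wheel_def)
  have n: "?n \<ge> 4" and dist: "distinct hs"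
    and adj: "\<And>i j. i < ?n \<Longrightarrow> j < ?n \<Longrightarrow>
      E (hs ! i) (hs ! j) \<longleftrightarrow> j = Suc i mod ?n \<or> i = Suc j mod ?n"
    using hole by (auto simp: is_hole_def)
  have hs_ne: "hs \<noteq> []" using n by auto
  have eq: "hs ! i = hs ! j \<longleftrightarrow> i = j" if "i < ?n" "j < ?n" for i j
    using that dist by (simp add: nth_eq_iff_index_eq)
  have nbrs: "E v a" "E v b" "E v c" "E v d" using nb by auto
  \<comment> \<open>Both long sectors have inner vertices: \<open>k = 0\<close> leaves only two
    neighbours of \<open>v\<close>, while \<open>k = 1\<close>, \<open>k = 2\<close> or
    \<open>Suc k = ?n - 1\<close> makes three neighbours consecutive.\<close>
  have k0: "k \<noteq> 0"
  proof
    assume "k = 0"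
    then have "{x \<in> set hs. E v x} = {a, b}" using nb abcd by auto
    then have "card {x \<in> set hs. E v x} \<le> 2" by (simp add: card_insert_if)
    then show False using card3 by simp
  qed
  have "\<not> E v (hs ! 2)"
    using line_wheel_no_three_consecutive[OF wheel, of 0] n hs_ne nbrs abcd
    by (simp add: numeral_2_eq_2)
  then have k12: "k \<noteq> 1" "k \<noteq> 2" using nbrs abcd by (auto simp: numeral_2_eq_2)
  have "\<not> E v (hs ! (?n - 1))"
  proof
    assume l: "E v (hs ! (?n - 1))"
    have "Suc (?n - 1) mod ?n = 0" using hs_ne by simp
    then show False
      using line_wheel_no_three_consecutive[OF wheel, of "?n - 1"] l n hs_ne nbrs abcd by simp
  qed
  then have kn: "Suc k \<noteq> ?n - 1" using nbrs abcd by auto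
  have k: "3 \<le> k" "Suc (Suc k) < ?n" using k0 k12 kn abcd(3) by auto
  have adj': "E (hs ! i) (hs ! j) \<longleftrightarrow>
      j = Suc i \<or> i = Suc j \<or> i = 0 \<and> Suc j = ?n \<or> j = 0 \<and> Suc i = ?n"
    if "i < ?n" "j < ?n" for i j
    unfolding adj[OF that] using that n by (auto simp: mod_Suc)
  \<comment> \<open>\<open>?I\<close> is the arc from \<open>d\<close> onwards around to
    \<open>a\<close>, and \<open>?J\<close> the arc from \<open>b\<close> to
    \<open>c\<close>.\<close>
  let ?I = "(!) hs ` ({0} \<union> {Suc k..<?n})" and ?J = "(!) hs ` {1..k}"
  have "0 \<in> {0} \<union> {Suc k..<?n}" "Suc k \<in> {0} \<union> {Suc k..<?n}" "1 \<in> {1..k}" "k \<in> {1..k}"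
    using k by auto
  then have abIJ: "a \<in> ?I" "d \<in> ?I" "b \<in> ?J" "c \<in> ?J"
    using abcd by (metis imageI)+
  have PI: "set P \<subseteq> ?I"
  proof (rule path_confined[OF P(1)])
    show "hd P \<in> ?I" using P(2) abIJ(1) by simp
    fix x y assume x: "x \<in> ?I" and y: "y \<in> set P" "y \<notin> ?I" and E: "E x y"
    obtain i where i: "x = hs ! i" "i = 0 \<or> Suc k \<le> i" "i < ?n" using x n by fastforce
    have "y \<in> set hs" using y(1) P(4) by blast
    then obtain j where j: "y = hs ! j" "j < ?n" by (auto simp: in_set_conv_nth)
    \<comment> \<open>Since \<open>P\<close> avoids \<open>b\<close>, which has index 1, it cannot
      leave the arc at \<open>a\<close>; only \<open>d\<close> remains.\<close>
    have "j \<noteq> 0" "j \<noteq> 1" "\<not> Suc k \<le> j" using y P(4) j abcd by auto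
    then have "i = Suc k" using E i j adj'[of i j] k by auto
    then show "x = last P" using i P(3) abcd by simp
  qed
  have QJ: "set Q \<subseteq> ?J"
  proof (rule path_confined[OF Q(1)])
    show "hd Q \<in> ?J" using Q(2) abIJ(3) by simp
    fix x y assume x: "x \<in> ?J" and y: "y \<in> set Q" "y \<notin> ?J" and E: "E x y"
    obtain i where i: "x = hs ! i" "1 \<le> i" "i \<le> k" using x by auto
    have "y \<in> set hs" using y(1) Q(4) by blast
    then obtain j where j: "y = hs ! j" "j < ?n" by (auto simp: in_set_conv_nth)
    have "j \<noteq> 0" "\<not> (1 \<le> j \<and> j \<le> k)" using y Q(4) j abcd by auto
    then have "i = k" using E i j adj'[of i j] k by auto
    then show "x = last Q" using i Q(3) abcd by simp
  qed
  \<comment> \<open>\<open>is_wheel\<close> does not state this; a vertex of a hole is never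
    adjacent to two consecutive vertices of it, whereas \<open>v\<close> is adjacent to
    \<open>a\<close> and \<open>b\<close>.\<close>
  have vhs: "v \<notin> set hs"
  proof
    assume "v \<in> set hs"
    then obtain m where m: "v = hs ! m" "m < ?n" by (auto simp: in_set_conv_nth)
    then have "m = 1 \<or> Suc m = ?n" "m = 0 \<or> m = 2"
      using nbrs(1,2) adj'[of m 0] adj'[of m 1] n hs_ne abcd by auto
    then show False using n by auto
  qed
  have IJ: "x \<noteq> y" "E x y \<longleftrightarrow> x = a \<and> y = b \<or> x = d \<and> y = c" if xy: "x \<in> ?I" "y \<in> ?J" for x y
  proof -
    obtain i where i: "x = hs ! i" "i = 0 \<or> Suc k \<le> i" "i < ?n" using xy n by fastforce
    obtain j where j: "y = hs ! j" "1 \<le> j" "j \<le> k" using xy by auto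
    have jn: "j < ?n" using j k by simp
    show "x \<noteq> y" using eq[of i j] i j jn by auto
    have "x = a \<longleftrightarrow> i = 0" "y = b \<longleftrightarrow> j = 1" "x = d \<longleftrightarrow> i = Suc k" "y = c \<longleftrightarrow> j = k"
      using eq[of i 0] eq[of j 1] eq[of i "Suc k"] eq[of j k] i j jn k hs_ne abcd by auto
    moreover have "E x y \<longleftrightarrow> i = 0 \<and> j = 1 \<or> i = Suc k \<and> j = k"
      unfolding i j using adj'[of i j] i(2,3) j(2,3) jn k hs_ne by auto
    ultimately show "E x y \<longleftrightarrow> x = a \<and> y = b \<or> x = d \<and> y = c" by simp
  qed
  have ad: "a \<noteq> d" "\<not> E a d" "b \<noteq> c" "\<not> E b c"
    using eq[of 0 "Suc k"] adj'[of 0 "Suc k"] eq[of 1 k] adj'[of 1 k] k hs_ne abcd by auto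
  have nbr_iff: "E v x \<longleftrightarrow> x \<in> {a, b, c, d}" if "x \<in> set hs" for x
    using nb that by blast
  show ?thesis
  proof unfold_locales
    show "v \<in> V" "v \<notin> set P" "v \<notin> set Q" using vV vhs P(4) Q(4) by auto
    show "is_path V E P" "is_path V E Q" by fact+
    show "3 \<le> length P" "3 \<le> length Q"
      using length_path_ge_3[OF P(1)] length_path_ge_3[OF Q(1)] P(2,3) Q(2,3) ad by auto
    show "set P \<inter> set Q = {}" using PI QJ IJ(1) by blast
    show "E v x \<longleftrightarrow> x = hd P \<or> x = last P" if "x \<in> set P" for x
    proof -
      have "x \<in> set hs" "x \<noteq> b" "x \<noteq> c" using that P(4) PI abIJ IJ(1) by blast+
      then show ?thesis using nbr_iff[of x] P(2,3) by auto
    qed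
    show "E v x \<longleftrightarrow> x = hd Q \<or> x = last Q" if "x \<in> set Q" for x
    proof -
      have "x \<in> set hs" "x \<noteq> a" "x \<noteq> d" using that Q(4) QJ abIJ IJ(1) by blast+
      then show ?thesis using nbr_iff[of x] Q(2,3) by auto
    qed
    show "E x y \<longleftrightarrow> x = hd P \<and> y = hd Q \<or> x = last P \<and> y = last Q"
      if "x \<in> set P" "y \<in> set Q" for x y
      using IJ(2)[of x y] that PI QJ P(2,3) Q(2,3) by blast
  qed
qed

theorem theorem5p4:
  fixes V :: "'a set" and E :: "'a \<Rightarrow> 'a \<Rightarrow> bool"
    and hs P Q :: "'a list" and v a b c d :: 'a and k :: nat
  assumes "graph V E" and "perfect V E" and "C4_free V E" and "prism_free V E"
    and "line_wheel V E hs v"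
    and "hs ! 0 = a" and "hs ! 1 = b" and "Suc k < length hs"
    and "hs ! k = c" and "hs ! Suc k = d"
    and "{x \<in> set hs. E v x} = {a, b, c, d}"
    and "is_path V E P" and "hd P = a" and "last P = d" and "set P \<subseteq> set hs - {b}"
    and "is_path V E Q" and "hd Q = b" and "last Q = c" and "set Q \<subseteq> set hs - {a}"
  shows "(\<forall>R. path_from V E (set P - {a}) (set Q - {c}) R \<and> v \<notin> set R
              \<longrightarrow> (\<exists>x\<in>set R. E v x))
       \<and> (\<forall>R. path_from V E (set P - {d}) (set Q - {b}) R \<and> v \<notin> set R
              \<longrightarrow> (\<exists>x\<in>set R. E v x))
       \<and> breaks V E v ({a} \<union> interior Q) \<and> breaks V E v ({d} \<union> interior Q)
       \<and> breaks V E v ({b} \<union> interior P) \<and> breaks V E v ({c} \<union> interior P)"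
proof -
  interpret PQ: line_wheel_paths V E v P Q
    by (rule line_wheel_paths_of_line_wheel[OF assms])
  interpret rPQ: line_wheel_paths V E v "rev P" "rev Q" by (rule PQ.reversed)
  interpret QP: line_wheel_paths V E v Q P by (rule PQ.swapped)
  interpret rQP: line_wheel_paths V E v "rev Q" "rev P" by (rule QP.reversed)
  have ends: "hd P = a" "last P = d" "hd Q = b" "last Q = c" by fact+
  have rev_ends: "hd (rev P) = d" "last (rev P) = a" "hd (rev Q) = c" "last (rev Q) = b"
    using ends by (simp_all add: hd_rev last_rev)
  have interior_rev: "interior (rev P) = interior P" "interior (rev Q) = interior Q"
    using ends rev_ends by (auto simp: interior_def)
  \<comment> \<open>The second family of paths comes from reversing both \<open>P\<close> and
    \<open>Q\<close>; the four sets come from \<open>breaks_last\<close> under the four symmetries,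
    with \<open>last\<close> equal to \<open>d\<close>, \<open>a\<close>, \<open>c\<close>,
    \<open>b\<close> in turn.\<close>
  show ?thesis
    using PQ.path_from_meets_nbhd rPQ.path_from_meets_nbhd
      PQ.breaks_last rPQ.breaks_last QP.breaks_last rQP.breaks_last
    unfolding ends rev_ends interior_rev set_rev by blast
qed

end
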